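(* Let $G$ be a finite regular partial cube that is not isomorphic to $K_1$ or $K_2$. Then every convex cycle of $G$ is a $6$-cycle if and only if $G$ is isomorphic to the Doubled Odd graph $\tilde{O}_k$ for some $k\geqslant 2$.
   Context: All graphs are finite, simple and undirected. A subgraph $H$ of $G$ is isometric if $d_H(u,v)=d_G(u,v)$ for all $u,v\in V(H)$, and convex if moreover every shortest $u,v$-path in $G$ (for $u,v\in V(H)$) lies in $H$. A partial cube is a graph isomorphic to an isometric subgraph of some hypercube $Q_n$ (vertices: 0-1 sequences of length $n$, adjacent iff differing in exactly one position). A convex cycle is a cycle that is a convex subgraph; an $l$-cycle is a cycle with $l$ edges. For $k\geqslant 1$, the Doubled Odd graph $\tilde{O}_k$ is the bipartite graph whose two parts are the set of $(k-1)$-element subsets and the set of $k$-element subsets of $\{1,\dots,2k-1\}$, where a $(k-1)$-subset $u$ and a $k$-subset $v$ are adjacent iff $u\subset v$. *)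

theory Defs
  imports Main "HOL-Library.Extended_Nat"
begin

definition graph :: "'a set \<Rightarrow> ('a \<Rightarrow> 'a \<Rightarrow> bool) \<Rightarrow> bool" where
  "graph V E \<longleftrightarrow> finite V \<and> (\<forall>u v. E u v \<longrightarrow> u \<in> V \<and> v \<in> V)
     \<and> (\<forall>u v. E u v \<longrightarrow> E v u) \<and> (\<forall>u. \<not> E u u)"

definition walk :: "('a \<Rightarrow> 'a \<Rightarrow> bool) \<Rightarrow> 'a list \<Rightarrow> bool" where
  "walk E xs \<longleftrightarrow> xs \<noteq> [] \<and> (\<forall>i. Suc i < length xs \<longrightarrow> E (xs ! i) (xs ! Suc i))"

definition gdist :: "('a \<Rightarrow> 'a \<Rightarrow> bool) \<Rightarrow> 'a \<Rightarrow> 'a \<Rightarrow> enat" where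
  "gdist E u v = (INF n \<in> {n. \<exists>xs. walk E xs \<and> hd xs = u \<and> last xs = v \<and> length xs = Suc n}. enat n)"

definition subgraph :: "'a set \<Rightarrow> ('a \<Rightarrow> 'a \<Rightarrow> bool) \<Rightarrow> 'a set \<Rightarrow> ('a \<Rightarrow> 'a \<Rightarrow> bool) \<Rightarrow> bool" where
  "subgraph VH EH V E \<longleftrightarrow> graph VH EH \<and> VH \<subseteq> V \<and> (\<forall>u v. EH u v \<longrightarrow> E u v)"

definition isometric_subgraph :: "'a set \<Rightarrow> ('a \<Rightarrow> 'a \<Rightarrow> bool) \<Rightarrow> 'a set \<Rightarrow> ('a \<Rightarrow> 'a \<Rightarrow> bool) \<Rightarrow> bool" where
  "isometric_subgraph VH EH V E \<longleftrightarrow> subgraph VH EH V E \<and>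
     (\<forall>u\<in>VH. \<forall>v\<in>VH. gdist EH u v = gdist E u v)"

definition convex_subgraph :: "'a set \<Rightarrow> ('a \<Rightarrow> 'a \<Rightarrow> bool) \<Rightarrow> 'a set \<Rightarrow> ('a \<Rightarrow> 'a \<Rightarrow> bool) \<Rightarrow> bool" where
  "convex_subgraph VH EH V E \<longleftrightarrow> isometric_subgraph VH EH V E \<and>
     (\<forall>u\<in>VH. \<forall>v\<in>VH. \<forall>xs. walk E xs \<and> hd xs = u \<and> last xs = v
         \<and> enat (length xs - 1) = gdist E u v
       \<longrightarrow> set xs \<subseteq> VH \<and> walk EH xs)"

definition is_cycle :: "'a set \<Rightarrow> ('a \<Rightarrow> 'a \<Rightarrow> bool) \<Rightarrow> nat \<Rightarrow> bool" where
  "is_cycle VH EH l \<longleftrightarrow> 3 \<le> l \<and> (\<exists>xs. length xs = l \<and> distinct xs \<and> set xs = VH \<and>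
     (\<forall>u v. EH u v \<longleftrightarrow> (\<exists>i<l. (u = xs ! i \<and> v = xs ! ((i + 1) mod l))
                                \<or> (v = xs ! i \<and> u = xs ! ((i + 1) mod l)))))"

definition convex_cycle :: "'a set \<Rightarrow> ('a \<Rightarrow> 'a \<Rightarrow> bool) \<Rightarrow> nat \<Rightarrow> 'a set \<Rightarrow> ('a \<Rightarrow> 'a \<Rightarrow> bool) \<Rightarrow> bool" where
  "convex_cycle VH EH l V E \<longleftrightarrow> is_cycle VH EH l \<and> convex_subgraph VH EH V E"

definition graph_iso :: "'a set \<Rightarrow> ('a \<Rightarrow> 'a \<Rightarrow> bool) \<Rightarrow> 'b set \<Rightarrow> ('b \<Rightarrow> 'b \<Rightarrow> bool) \<Rightarrow> bool" where
  "graph_iso V E W F \<longleftrightarrow> (\<exists>f. bij_betw f V W \<and> (\<forall>u\<in>V. \<forall>v\<in>V. E u v \<longleftrightarrow> F (f u) (f v)))"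

definition cube_V :: "nat \<Rightarrow> bool list set" where
  "cube_V n = {xs. length xs = n}"

definition cube_E :: "nat \<Rightarrow> bool list \<Rightarrow> bool list \<Rightarrow> bool" where
  "cube_E n xs ys \<longleftrightarrow> xs \<in> cube_V n \<and> ys \<in> cube_V n \<and> card {i. i < n \<and> xs ! i \<noteq> ys ! i} = 1"

definition partial_cube :: "'a set \<Rightarrow> ('a \<Rightarrow> 'a \<Rightarrow> bool) \<Rightarrow> bool" where
  "partial_cube V E \<longleftrightarrow> (\<exists>n VH EH. isometric_subgraph VH EH (cube_V n) (cube_E n) \<and> graph_iso V E VH EH)"

definition regular :: "'a set \<Rightarrow> ('a \<Rightarrow> 'a \<Rightarrow> bool) \<Rightarrow> bool" where
  "regular V E \<longleftrightarrow> (\<exists>d. \<forall>v\<in>V. card {u\<in>V. E v u} = d)"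

definition K_V :: "nat \<Rightarrow> nat set" where "K_V n = {0..<n}"
definition K_E :: "nat \<Rightarrow> nat \<Rightarrow> nat \<Rightarrow> bool" where
  "K_E n i j \<longleftrightarrow> i < n \<and> j < n \<and> i \<noteq> j"

definition DO_V :: "nat \<Rightarrow> nat set set" where
  "DO_V k = {A. A \<subseteq> {1..2*k-1} \<and> (card A = k - 1 \<or> card A = k)}"

definition DO_E :: "nat \<Rightarrow> nat set \<Rightarrow> nat set \<Rightarrow> bool" where
  "DO_E k A B \<longleftrightarrow> A \<in> DO_V k \<and> B \<in> DO_V k \<and>
     ((card A = k - 1 \<and> card B = k \<and> A \<subset> B) \<or> (card B = k - 1 \<and> card A = k \<and> B \<subset> A))"

end

theory Submission
  imports Defs
begin

text \<open>
  Embed the graph as an isometric family of sets, with edges flipping one element. Two nearest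
  parallel edges span a convex cycle, hence a hexagon; so there are no squares, and parallel edges
  lie at even distance. An exchange property follows: if \<open>y\<close> and \<open>z\<close> are flippable at \<open>D\<close>
  and \<open>q\<close> is flippable after \<open>y\<close>, all three towards a common vertex, then \<open>q\<close> is flippable
  after \<open>z\<close>. With degree \<open>d\<close>, let \<open>v\<close> be farthest from the empty set (after translation) and
  let \<open>Y\<close> be the set of flippable elements there. Exchange builds balanced layers over \<open>Y\<close> up to
  \<open>v\<close>, so \<open>v\<close> has \<open>2d - 1\<close> elements and the same \<open>d\<close> directions; extremality of \<open>v\<close> then shows that
  the family consists of all \<open>X \<subseteq> v\<close> with \<open>|X \<inter> Y| - |X - Y| \<in> {0, 1}\<close>. Flipping \<open>Y\<close> turns these
  into the two middle layers. Conversely, in the middle layers a path flipping \<open>x, y, z\<close> has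
  the second geodesic \<open>z, y, x\<close>, which closes every convex cycle after six steps.
\<close>

section \<open>Symmetric differences and hexagonal families\<close>

definition xor :: "'e set \<Rightarrow> 'e set \<Rightarrow> 'e set" (infixl "\<oplus>" 65) where
  "A \<oplus> B = (A - B) \<union> (B - A)"

lemma in_xor_iff [simp]: "x \<in> A \<oplus> B \<longleftrightarrow> (x \<in> A) \<noteq> (x \<in> B)"
  by (auto simp: xor_def)

lemma finite_xor [simp]: "finite A \<Longrightarrow> finite B \<Longrightarrow> finite (A \<oplus> B)"
  by (auto simp: xor_def)

lemma xor_assoc: "A \<oplus> B \<oplus> C = A \<oplus> (B \<oplus> C)"
  by (auto simp: set_eq_iff)

lemma xor_commute: "A \<oplus> B = B \<oplus> A"
  by (auto simp: set_eq_iff)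

lemma xor_self [simp]: "A \<oplus> A = {}"
  by (auto simp: set_eq_iff)

lemma xor_empty [simp]: "A \<oplus> {} = A" "{} \<oplus> A = A"
  by (auto simp: set_eq_iff)

lemma xor_cancel [simp]: "A \<oplus> (A \<oplus> B) = B"
  by (auto simp: set_eq_iff)

lemma xor_cancel_translate [simp]: "(D \<oplus> A) \<oplus> (D \<oplus> B) = A \<oplus> B"
  by (auto simp: set_eq_iff)

lemma xor_left_inject [simp]: "D \<oplus> A = D \<oplus> B \<longleftrightarrow> A = B"
  by (auto simp: set_eq_iff)

lemma xor_eq_empty_iff [simp]: "A \<oplus> B = {} \<longleftrightarrow> A = B"
  by (auto simp: set_eq_iff)

lemma xor_subset: "A \<subseteq> B \<Longrightarrow> A \<oplus> B = B - A" "A \<subseteq> B \<Longrightarrow> B \<oplus> A = B - A"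
  by (auto simp: set_eq_iff)

lemma xor_disjoint: "A \<inter> B = {} \<Longrightarrow> A \<oplus> B = A \<union> B"
  by (auto simp: set_eq_iff)

lemma mem_xor_image_iff: "X \<in> (\<oplus>) D ` F \<longleftrightarrow> D \<oplus> X \<in> F"
  by (metis image_iff xor_cancel)

text \<open>The vertices of the antipodal cycle through the empty set that flips the coordinates
  \<open>es\<close> one by one, and then flips them back in the same order.\<close>
definition cyc :: "'e list \<Rightarrow> nat \<Rightarrow> 'e set" where
  "cyc es i = (if i \<le> length es then set (take i es) else set (drop (i - length es) es))"

text \<open>In an isometric family the members inside a subcube form a convex set, so the last
  assumption says that convex cycles, read off as traces on subcubes, have length six. The bound
  \<open>2 \<le> length es\<close> keeps a single edge, which \<open>cyc [e]\<close> would list,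
  from counting as a cycle.\<close>

locale hexagonal_family =
  fixes F :: "'e set set"
  assumes finite_member: "A \<in> F \<Longrightarrow> finite A"
    and isometric: "A \<in> F \<Longrightarrow> B \<in> F \<Longrightarrow> A \<noteq> B \<Longrightarrow> \<exists>e\<in>A \<oplus> B. A \<oplus> {e} \<in> F"
    and hexagonal: "D \<in> F \<Longrightarrow> distinct es \<Longrightarrow> 2 \<le> length es \<Longrightarrow>
      {R. R \<subseteq> set es \<and> D \<oplus> R \<in> F} = cyc es ` {..<2 * length es} \<Longrightarrow> length es = 3"
begin

text \<open>Flipping the coordinates in \<open>D\<close> is a symmetry of the cube, so later
  arguments may place any chosen member at the empty set.\<close>

lemma translate: 
  assumes "finite D"
  shows "hexagonal_family ((\<oplus>) D ` F)"
proof
  fix A assume "A \<in> (\<oplus>) D ` F"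
  then show "finite A" using assms finite_member by auto
next
  fix A B assume "A \<in> (\<oplus>) D ` F" "B \<in> (\<oplus>) D ` F" "A \<noteq> B"
  then have "\<exists>e\<in>(D \<oplus> A) \<oplus> (D \<oplus> B). (D \<oplus> A) \<oplus> {e} \<in> F"
    unfolding mem_xor_image_iff by (intro isometric) auto
  then show "\<exists>e\<in>A \<oplus> B. A \<oplus> {e} \<in> (\<oplus>) D ` F"
    by (simp add: mem_xor_image_iff) (simp add: xor_assoc)
next
  fix A es
  assume "A \<in> (\<oplus>) D ` F" "distinct es" "2 \<le> length es"
    "{R. R \<subseteq> set es \<and> A \<oplus> R \<in> (\<oplus>) D ` F} = cyc es ` {..<2 * length es}"
  then show "length es = 3"
    using hexagonal[of "D \<oplus> A" es] by (simp only: mem_xor_image_iff xor_assoc)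
qed

lemma step_up:
  assumes "A \<in> F" "B \<in> F" "A \<subset> B"
  shows "\<exists>e\<in>B - A. insert e A \<in> F"
proof -
  obtain e where e: "e \<in> A \<oplus> B" "A \<oplus> {e} \<in> F" using isometric[of A B] assms by blast
  moreover have "A \<oplus> {e} = insert e A" "e \<in> B - A" using e(1) assms by (auto simp: set_eq_iff)
  ultimately show ?thesis by metis
qed

lemma step_down:
  assumes "A \<in> F" "B \<in> F" "A \<subset> B"
  shows "\<exists>e\<in>B - A. B - {e} \<in> F"
proof -
  obtain e where e: "e \<in> B \<oplus> A" "B \<oplus> {e} \<in> F" using isometric[of B A] assms by blast
  moreover have "B \<oplus> {e} = B - {e}" "e \<in> B - A" using e(1) assms by (auto simp: set_eq_iff)
  ultimately show ?thesis by metis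
qed

text \<open>The four sets fill a two-dimensional subcube and are exactly the values of
  \<open>cyc [a, b]\<close>, so they would form a convex 4-cycle.\<close>

lemma no_square:
  assumes "X \<in> F" "insert a X \<in> F" "insert b X \<in> F" "insert a (insert b X) \<in> F"
    and "a \<noteq> b" "a \<notin> X" "b \<notin> X"
  shows False
proof -
  have cyc: "cyc [a, b] ` {..<2 * length [a, b]} = {{}, {a}, {a, b}, {b}}"
    by (auto simp: cyc_def lessThan_Suc eval_nat_numeral)
  have "X \<oplus> {a} = insert a X" "X \<oplus> {b} = insert b X" "X \<oplus> {a, b} = insert a (insert b X)"
    using assms by (auto simp: set_eq_iff)
  moreover have "R \<subseteq> {a, b} \<longleftrightarrow> R \<in> {{}, {a}, {a, b}, {b}}" for R
    by auto
  ultimately have "{R. R \<subseteq> set [a, b] \<and> X \<oplus> R \<in> F} = cyc [a, b] ` {..<2 * length [a, b]}"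
    unfolding cyc using assms by auto
  from hexagonal[OF _ _ _ this] assms show False by simp
qed

text \<open>The two given sets differ only in \<open>a\<close> and \<open>b\<close>, so an isometric
  step from the first leads to \<open>X\<close>, which is excluded, or to the top of the square.
  Usually \<open>no_square\<close> is what excludes \<open>X\<close>.\<close>

lemma diamond_up:
  assumes "insert a X \<in> F" "insert b X \<in> F" "a \<noteq> b" "a \<notin> X" "b \<notin> X" "X \<notin> F"
  shows "insert a (insert b X) \<in> F"
proof -
  obtain e where e: "e \<in> insert a X \<oplus> insert b X" "insert a X \<oplus> {e} \<in> F"
    using isometric[of "insert a X" "insert b X"] assms by blast
  have "insert a X \<oplus> {a} = X" "insert a X \<oplus> {b} = insert a (insert b X)" "e = a \<or> e = b"
    using assms e(1) by (auto simp: set_eq_iff)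
  then show ?thesis using e assms by auto
qed

lemma diamond_down:
  assumes "insert a (insert b X) \<in> F" "X \<in> F" "a \<noteq> b" "a \<notin> X" "b \<notin> X" "insert a X \<notin> F"
  shows "insert b X \<in> F"
  using step_up[of X "insert a (insert b X)"] assms by auto

end

section \<open>Parallel edges\<close>

text \<open>For nonempty \<open>R\<close>, let \<open>i\<close> be the last index whose prefix is
  disjoint from \<open>R\<close>. The next prefix meets \<open>R\<close>, hence covers
  \<open>set es\<close> together with it, and its only new element already lies in \<open>R\<close>;
  so \<open>R\<close> is the complement of the prefix of length \<open>i\<close>.\<close>

lemma eq_set_drop_if_disjoint_or_cover:
  assumes "distinct es" "R \<subseteq> set es"
    and "\<And>i. i \<le> length es \<Longrightarrow> R \<inter> set (take i es) = {} \<or> R \<union> set (take i es) = set es"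
  shows "\<exists>i\<le>length es. R = set (drop i es)"
proof (cases "R = {}")
  case True
  then show ?thesis by (intro exI[of _ "length es"]) simp
next
  case False
  define P where "P i \<longleftrightarrow> i \<le> length es \<and> R \<inter> set (take i es) = {}" for i
  define i where "i = (GREATEST i. P i)"
  have "P 0" by (simp add: P_def)
  have "P i" unfolding i_def
    using GreatestI_nat[of P 0 "length es"] \<open>P 0\<close> by (auto simp: P_def)
  moreover have "i \<noteq> length es" using \<open>P i\<close> False assms(2) by (auto simp: P_def Int_absorb2)
  ultimately have i: "i < length es" "R \<inter> set (take i es) = {}" by (auto simp: P_def)
  have "\<not> P (Suc i)"
    using Greatest_le_nat[where b = "length es" and P = P and k = "Suc i"]
    unfolding i_def[symmetric] using P_def by fastforce
  then have meet: "R \<inter> set (take (Suc i) es) \<noteq> {}"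
    and cover: "R \<union> set (take (Suc i) es) = set es"
    using i assms(3)[of "Suc i"] by (auto simp: P_def)
  have Suc: "set (take (Suc i) es) = insert (es ! i) (set (take i es))"
    using i by (simp add: take_Suc_conv_app_nth)
  then have "es ! i \<in> R" using meet i(2) by auto
  then have "R \<union> set (take i es) = set es"
    using cover Suc by (metis Un_insert_left Un_insert_right insert_absorb)
  then have "R = set es - set (take i es)" using i(2) assms(2) by auto
  moreover have "set es = set (take i es) \<union> set (drop i es)"
    by (metis append_take_drop_id set_append)
  moreover have "set (take i es) \<inter> set (drop i es) = {}"
    using set_take_disj_set_drop_if_distinct[OF assms(1), of i i] by simp
  ultimately have "R = set (drop i es)" by auto
  then show ?thesis using less_imp_le[OF i(1)] by blast
qed

context hexagonal_family
begin

text \<open>A geodesic from \<open>A\<close> to \<open>B\<close> has to flip \<open>y\<close> at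
  some point, and all its vertices lie between the intersection and the union of its ends. The
  induction walks along it until that flip.\<close>

lemma crossing:
  assumes "A \<in> F" "B \<in> F" "y \<notin> A" "y \<in> B"
  shows "\<exists>X\<in>F. y \<notin> X \<and> insert y X \<in> F \<and> A \<inter> B \<subseteq> X \<and> X \<subseteq> A \<union> B"
  using assms
proof (induction "card (A \<oplus> B)" arbitrary: A rule: less_induct)
  case less
  obtain e where e: "e \<in> A \<oplus> B" "A \<oplus> {e} \<in> F" using isometric[of A B] less.prems by blast
  show ?case
  proof (cases "e = y")
    case True
    then have "insert y A \<in> F" using e less.prems by (simp add: xor_disjoint)
    then show ?thesis using less.prems by blast
  next
    case False
    have "A \<oplus> {e} \<oplus> B = (A \<oplus> B) - {e}" using e by (auto simp: set_eq_iff)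
    then have "card (A \<oplus> {e} \<oplus> B) < card (A \<oplus> B)"
      using e less.prems finite_member by (metis card_Diff1_less finite_xor)
    then obtain X where X: "X \<in> F" "y \<notin> X" "insert y X \<in> F"
      "(A \<oplus> {e}) \<inter> B \<subseteq> X" "X \<subseteq> (A \<oplus> {e}) \<union> B"
      using less.hyps[of "A \<oplus> {e}"] e less.prems False by auto
    have "A \<inter> B \<subseteq> (A \<oplus> {e}) \<inter> B" "(A \<oplus> {e}) \<union> B \<subseteq> A \<union> B" using e(1) by auto
    then show ?thesis using X by blast
  qed
qed

lemma ascending_chain:
  assumes "A \<in> F" "B \<in> F" "A \<subseteq> B"
  shows "\<exists>es. distinct es \<and> set es = B - A \<and> (\<forall>i\<le>length es. A \<union> set (take i es) \<in> F)"
  using assms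
proof (induction "card (B - A)" arbitrary: A rule: less_induct)
  case less
  show ?case
  proof (cases "A = B")
    case True
    then show ?thesis using less.prems by (intro exI[of _ "[]"]) auto
  next
    case False
    then obtain e where e: "e \<in> B - A" "insert e A \<in> F" using step_up[of A B] less.prems by blast
    have "B - insert e A = (B - A) - {e}" by auto
    then have "card (B - insert e A) < card (B - A)"
      using e less.prems finite_member by (metis card_Diff1_less finite_Diff)
    then obtain es where es: "distinct es" "set es = B - insert e A"
      "\<forall>i\<le>length es. insert e A \<union> set (take i es) \<in> F"
      using less.hyps[of "insert e A"] e less.prems by auto
    have "A \<union> set (take i (e # es)) \<in> F" if "i \<le> length (e # es)" for i
      using that es(3) less.prems by (cases i) auto
    then show ?thesis using es e by (intro exI[of _ "e # es"]) auto
  qed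
qed

text \<open>Between two edges of the same direction \<open>y\<close> that are nearest to each other, the two sides
  of the cut \<open>y\<close> are complementary chains, so the hull is a convex cycle.\<close>
lemma parallel_edges_hexagon:
  assumes "{} \<in> F" "{y} \<in> F" "B \<in> F" "insert y B \<in> F" "y \<notin> B" "B \<noteq> {}"
  shows "\<exists>a b. a \<in> B \<and> b \<in> B \<and> a \<noteq> b \<and> {a} \<in> F \<and> {a, b} \<in> F \<and> {y, b} \<in> F \<and> {y, a, b} \<in> F"
proof -
  \<comment> \<open>\<open>C\<close> will be a least nonempty subset of \<open>B\<close> that
    carries an edge of direction \<open>y\<close>. By \<open>U\<close>, inside \<open>C\<close> such
    edges occur only at the empty set and at \<open>C\<close> itself.\<close>
  define P where "P C \<longleftrightarrow> C \<subseteq> B \<and> C \<noteq> {} \<and> C \<in> F \<and> insert y C \<in> F" for C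
  have "P B" using assms by (auto simp: P_def)
  then obtain C where C: "P C" "\<And>X. P X \<Longrightarrow> card C \<le> card X"
    using ex_has_least_nat[of P B card] by blast
  have "finite C" using C finite_member by (auto simp: P_def)
  have U: "X = {} \<or> X = C" if "X \<subseteq> C" "X \<in> F" "insert y X \<in> F" for X
  proof (rule ccontr)
    assume "\<not> ?thesis"
    then have "P X" "X \<subset> C" using that C by (auto simp: P_def)
    then show False using C(2)[of X] psubset_card_mono[OF \<open>finite C\<close>, of X] by auto
  qed
  have yC: "y \<notin> C" using C assms by (auto simp: P_def)
  have CF: "C \<in> F" "insert y C \<in> F" using C by (auto simp: P_def)
  \<comment> \<open>\<open>R\<close> lies on the side of the cut without \<open>y\<close>, and
    \<open>insert y S\<close> on the other. Between them there is a \<open>y\<close>-edge at a set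
    between \<open>R \<inter> S\<close> and \<open>R \<union> S\<close>, which by minimality is
    empty or all of \<open>C\<close>.\<close>
  have cross: "R \<inter> S = {} \<or> R \<union> S = C"
    if RS: "R \<subseteq> C" "R \<in> F" "S \<subseteq> C" "insert y S \<in> F" for R S
  proof -
    obtain X where X: "X \<in> F" "y \<notin> X" "insert y X \<in> F"
      "R \<inter> insert y S \<subseteq> X" "X \<subseteq> R \<union> insert y S"
      using crossing[of R "insert y S" y] RS yC by blast
    then have "X \<subseteq> C" using RS by auto
    from U[OF this X(1,3)] show ?thesis using X RS by auto
  qed
  obtain es where es: "distinct es" "set es = C"
    "\<And>i. i \<le> length es \<Longrightarrow> insert y (set (take i es)) \<in> F"
    using ascending_chain[of "{y}" "insert y C"] assms CF yC by auto
  let ?m = "length es"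
  have take_sub: "set (take i es) \<subseteq> C" "set (drop i es) \<subseteq> C" for i
    using es(2) set_take_subset set_drop_subset by metis+
  have low: "\<exists>i\<le>?m. R = set (drop i es)" if "R \<subseteq> C" "R \<in> F" for R
    using eq_set_drop_if_disjoint_or_cover[of es R] that es take_sub cross by simp
  \<comment> \<open>A chain from the empty set to \<open>C\<close> has one set of every size, and by
    \<open>low\<close> each of them is a suffix of \<open>es\<close>; comparing sizes shows that
    every suffix occurs.\<close>
  have drop_in: "set (drop i es) \<in> F" if "i \<le> ?m" for i
  proof -
    obtain fs where fs: "distinct fs" "set fs = C" "\<And>i. i \<le> length fs \<Longrightarrow> set (take i fs) \<in> F"
      using ascending_chain[of "{}" C] assms CF by auto
    have len: "length fs = ?m" using fs es distinct_card by metis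
    have "set (take (?m - i) fs) \<in> F" using fs(3) len by auto
    moreover have "set (take (?m - i) fs) \<subseteq> C" using fs(2) set_take_subset by metis
    ultimately obtain j where j: "j \<le> ?m" "set (take (?m - i) fs) = set (drop j es)"
      using low by blast
    have "card (set (take (?m - i) fs)) = ?m - i"
      using fs(1) len by (subst distinct_card) auto
    moreover have "card (set (drop j es)) = ?m - j"
      using es(1) by (subst distinct_card) auto
    ultimately have "j = i" using j that by auto
    then show ?thesis using j \<open>set (take (?m - i) fs) \<in> F\<close> by simp
  qed
  \<comment> \<open>The same dichotomy is applied on the other side of the cut, with the suffixes of
    \<open>es\<close> read as prefixes of \<open>rev es\<close>.\<close>
  have up: "\<exists>i\<le>?m. S = set (take i es)" if S: "S \<subseteq> C" "insert y S \<in> F" for S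
  proof -
    have "S \<inter> set (take i (rev es)) = {} \<or> S \<union> set (take i (rev es)) = set (rev es)"
      if "i \<le> length (rev es)" for i
      using cross[of "set (drop (?m - i) es)" S] drop_in[of "?m - i"] take_sub that S es(2)
      by (auto simp: take_rev)
    then obtain i where "i \<le> ?m" "S = set (drop i (rev es))"
      using eq_set_drop_if_disjoint_or_cover[of "rev es" S] es S by auto
    then show ?thesis by (intro exI[of _ "?m - i"]) (simp add: drop_rev)
  qed
  have "{R. R \<subseteq> set (y # es) \<and> {} \<oplus> R \<in> F} = cyc (y # es) ` {..<2 * length (y # es)}"
  proof (intro equalityI subsetI)
    fix R assume "R \<in> {R. R \<subseteq> set (y # es) \<and> {} \<oplus> R \<in> F}"
    then have R: "R \<subseteq> insert y C" "R \<in> F" using es by auto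
    show "R \<in> cyc (y # es) ` {..<2 * length (y # es)}"
    proof (cases "y \<in> R")
      case True
      then have "insert y (R - {y}) = R" by auto
      then obtain i where i: "i \<le> ?m" "R - {y} = set (take i es)"
        using up[of "R - {y}"] R by auto
      then have "R = cyc (y # es) (Suc i)" using True by (auto simp: cyc_def)
      then show ?thesis using i by auto
    next
      case False
      then obtain i where i: "i \<le> ?m" "R = set (drop i es)" using low[of R] R by auto
      show ?thesis
      proof (cases "i = ?m")
        case True
        then have "R = cyc (y # es) 0" using i by (simp add: cyc_def)
        then show ?thesis by (intro image_eqI[of _ _ 0]) auto
      next
        case False
        then have "R = cyc (y # es) (Suc (Suc (?m + i)))" using i by (simp add: cyc_def Suc_diff_le)
        then show ?thesis using i False by (intro image_eqI[of _ _ "Suc (Suc (?m + i))"]) auto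
      qed
    qed
  next
    fix R assume "R \<in> cyc (y # es) ` {..<2 * length (y # es)}"
    then obtain i where i: "i < 2 * Suc ?m" "R = cyc (y # es) i" by auto
    \<comment> \<open>The cycle starts at the empty set, runs through \<open>y\<close> joined with
      the prefixes of \<open>es\<close>, and, after \<open>y\<close> is flipped back, through the
      nonempty suffixes \<open>drop j es\<close>; this explains the offset
      \<open>Suc (Suc ?m + j)\<close>.\<close>
    consider "i = 0" | j where "i = Suc j" "j \<le> ?m" | j where "i = Suc (Suc ?m + j)" "j < ?m"
    proof (cases "i \<le> Suc ?m")
      case True
      then show ?thesis using that(1,2) by (cases i) auto
    next
      case False
      then show ?thesis using that(3)[of "i - Suc (Suc ?m)"] i(1) by simp
    qed
    then have "R = {} \<or> (\<exists>j\<le>?m. R = insert y (set (take j es)) \<or> R = set (drop j es))"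
    proof cases
      case 1
      then show ?thesis using i by (simp add: cyc_def)
    next
      case 2
      then show ?thesis using i by (auto simp: cyc_def)
    next
      case 3
      then have "R = set (drop j es)" using i by (simp add: cyc_def Suc_diff_le)
      then show ?thesis using 3 less_imp_le by blast
    qed
    then show "R \<in> {R. R \<subseteq> set (y # es) \<and> {} \<oplus> R \<in> F}"
    proof (elim disjE exE conjE)
      fix j assume "j \<le> ?m" "R = insert y (set (take j es))"
      then show ?thesis using es(2) es(3)[of j] take_sub(1)[of j] by auto
    next
      fix j assume "j \<le> ?m" "R = set (drop j es)"
      then show ?thesis using es(2) drop_in[of j] take_sub(2)[of j] by auto
    qed (use assms in simp)
  qed
  moreover have "distinct (y # es)" using es yC by simp
  moreover have "es \<noteq> []" using es C by (auto simp: P_def)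
  ultimately have "length (y # es) = 3" using hexagonal[of "{}" "y # es"] assms by (cases es) auto
  then obtain b a where ba: "es = [b, a]" by (auto simp: length_Suc_conv eval_nat_numeral)
  have "{a} \<in> F" "{a, b} \<in> F" using drop_in[of 1] drop_in[of 0] ba by (auto simp: insert_commute)
  moreover have "{y, b} \<in> F" "{y, a, b} \<in> F"
    using es(3)[of 1] es(3)[of 2] ba by (auto simp: insert_commute)
  moreover have "a \<in> B" "b \<in> B" "a \<noteq> b" using es ba C by (auto simp: P_def)
  ultimately show ?thesis by blast
qed

text \<open>Translation by \<open>B\<close> exchanges the positions \<open>{}\<close> and
  \<open>B\<close> of the two parallel edges, so the hexagon is now found next to
  \<open>B\<close>.\<close>

lemma parallel_edges_hexagon_down:
  assumes "{} \<in> F" "{y} \<in> F" "B \<in> F" "insert y B \<in> F" "y \<notin> B" "B \<noteq> {}"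
  shows "\<exists>a b. a \<in> B \<and> b \<in> B \<and> a \<noteq> b \<and> B - {a} \<in> F \<and> B - {a, b} \<in> F
    \<and> insert y (B - {b}) \<in> F \<and> insert y (B - {a, b}) \<in> F"
proof -
  interpret T: hexagonal_family "(\<oplus>) B ` F" by (rule translate[OF finite_member[OF assms(3)]])
  have "B \<oplus> insert y B = {y}" "B \<oplus> {y} = insert y B" using assms(5) by (auto simp: set_eq_iff)
  then have "{} \<in> (\<oplus>) B ` F" "{y} \<in> (\<oplus>) B ` F" "B \<in> (\<oplus>) B ` F"
    "insert y B \<in> (\<oplus>) B ` F"
    unfolding mem_xor_image_iff using assms by simp_all
  then obtain a b where ab: "a \<in> B" "b \<in> B" "a \<noteq> b" "B \<oplus> {a} \<in> F" "B \<oplus> {a, b} \<in> F"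
    "B \<oplus> {y, b} \<in> F" "B \<oplus> {y, a, b} \<in> F"
    using T.parallel_edges_hexagon[of y B] assms(5,6) unfolding mem_xor_image_iff by blast
  moreover have "B \<oplus> {a} = B - {a}" "B \<oplus> {a, b} = B - {a, b}"
    "B \<oplus> {y, b} = insert y (B - {b})" "B \<oplus> {y, a, b} = insert y (B - {a, b})"
    using ab(1,2) assms(5) by (auto simp: set_eq_iff)
  ultimately show ?thesis by (intro exI[of _ a] exI[of _ b]) simp
qed

text \<open>A hexagon next to \<open>B\<close> leads to an edge of the same direction at a set with
  two elements fewer, and induction descends to the empty set.\<close>

lemma even_card_if_parallel_edge:
  assumes "{} \<in> F" "{y} \<in> F" "B \<in> F" "insert y B \<in> F" "y \<notin> B"
  shows "even (card B)"
  using assms(3-)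
proof (induction "card B" arbitrary: B rule: less_induct)
  case less
  show ?case
  proof (cases "B = {}")
    case False
    then obtain a b where ab: "a \<in> B" "b \<in> B" "a \<noteq> b" "B - {a, b} \<in> F" "insert y (B - {a, b}) \<in> F"
      using parallel_edges_hexagon_down[of y B] assms less.prems by blast
    have "finite B" using less.prems finite_member by blast
    then have "card (B - {a, b}) = card B - 2" "2 \<le> card B"
      using ab(1-3) card_Diff_subset[of "{a, b}" B] card_mono[of B "{a, b}"] by simp_all
    moreover have "even (card (B - {a, b}))"
      using less.hyps[OF _ ab(4,5)] less.prems(3) calculation by simp
    ultimately show ?thesis by simp
  qed simp
qed

end

section \<open>The exchange property\<close>

text \<open>The induction on \<open>card v\<close> ranges over all families, because translated
  families enter. First an element \<open>q0\<close> is found that can follow both \<open>y\<close>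
  and \<open>z\<close>; an arbitrary \<open>q\<close> is then compared with \<open>q0\<close> after
  moving the base vertex to \<open>{y}\<close>.\<close>

lemma exchange_from_empty:
  assumes "hexagonal_family F" "{} \<in> F" "v \<in> F" "y \<in> v" "z \<in> v" "q \<in> v"
    and "{y} \<in> F" "{z} \<in> F" "{y, q} \<in> F" "q \<noteq> y" "q \<noteq> z"
  shows "{z, q} \<in> F"
  using assms
proof (induction "card v" arbitrary: F v y z q rule: less_induct)
  case less
  interpret hexagonal_family F by (rule less.prems)
  note F = less.prems(2,3,7-9)
  have "finite v" using finite_member F by blast
  show ?case
  proof (cases "y = z")
    case False
    have yzF: "{y, z} \<notin> F" using no_square[of "{}" y z] F False by auto
    text \<open>The hexagon at the edge of direction \<open>y\<close> beyond the cut \<open>z\<close> that is nearest to the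
      empty set leads, by parity, to a set \<open>t\<close> with edges in both directions \<open>y\<close> and \<open>z\<close>.\<close>
    define P where "P X \<longleftrightarrow> X \<in> F \<and> insert y X \<in> F \<and> y \<notin> X \<and> z \<in> X \<and> X \<subseteq> v" for X
    obtain X0 where "X0 \<in> F" "y \<notin> X0" "insert y X0 \<in> F" "{z} \<inter> v \<subseteq> X0" "X0 \<subseteq> {z} \<union> v"
      using crossing[of "{z}" v y] F False less.prems(4) by blast
    then have "P X0" using less.prems(5) by (auto simp: P_def)
    then obtain X where X: "P X" "\<And>X'. P X' \<Longrightarrow> card X \<le> card X'"
      using ex_has_least_nat[of P X0 card] by blast
    have XF: "X \<in> F" "insert y X \<in> F" "y \<notin> X" "z \<in> X" "X \<subseteq> v" using X(1) by (auto simp: P_def)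
    have "finite X" using finite_member XF by blast
    obtain a b where ab: "a \<in> X" "b \<in> X" "a \<noteq> b" "X - {a} \<in> F" "X - {a, b} \<in> F"
      "insert y (X - {b}) \<in> F" "insert y (X - {a, b}) \<in> F"
      using parallel_edges_hexagon_down[of y X] F XF by blast
    have even: "even (card X)" using even_card_if_parallel_edge[of y X] F XF by blast
    \<comment> \<open>With \<open>a = z\<close>, the sets \<open>X\<close> and
      \<open>X - {z}\<close> would carry edges parallel to the edges \<open>y\<close> and
      \<open>z\<close> at the empty set, so both would have even size.\<close>
    have "a \<noteq> z"
    proof
      assume "a = z"
      then have "even (card (X - {z}))"
        using even_card_if_parallel_edge[of z "X - {z}"] F XF ab by (simp add: insert_absorb)
      then show False using even card.remove[OF \<open>finite X\<close> XF(4)] by simp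
    qed
    \<comment> \<open>If neither removed element is \<open>z\<close>, the hexagon reaches a smaller
      \<open>y\<close>-edge still beyond the cut \<open>z\<close>, against the choice of
      \<open>X\<close>.\<close>
    have "b = z"
    proof (rule ccontr)
      assume "b \<noteq> z"
      then have "P (X - {a, b})" using ab(5,7) XF \<open>a \<noteq> z\<close> by (auto simp: P_def)
      moreover have "X - {a, b} \<subset> X" using ab(1) by auto
      ultimately show False
        using X(2)[of "X - {a, b}"] psubset_card_mono[OF \<open>finite X\<close>, of "X - {a, b}"] by linarith
    qed
    define t where "t = X - {a, z}"
    have az: "X - {a} = insert z t" "X - {z} = insert a t" "X = insert a (insert z t)"
      using ab(1,2) \<open>b = z\<close> \<open>a \<noteq> z\<close> by (auto simp: t_def)
    have tF: "t \<in> F" "insert y t \<in> F" "insert z t \<in> F" "insert y (insert a t) \<in> F"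
      using ab(4-7) unfolding \<open>b = z\<close> az(1,2) t_def[symmetric] by simp_all
    have t: "t \<subseteq> v" "y \<notin> t" "z \<notin> t" "a \<in> v" "a \<noteq> y" using XF ab(1) by (auto simp: t_def)
    \<comment> \<open>If \<open>t\<close> is empty, the hexagon starts at the empty set and
      \<open>a\<close> serves as \<open>q0\<close>. Otherwise the second of two steps
      \<open>p\<close>, \<open>q'\<close> towards \<open>t\<close> is transferred from
      \<open>p\<close> to \<open>y\<close> and to \<open>z\<close> by induction, with the smaller
      targets \<open>insert y t\<close> and \<open>insert z t\<close>.\<close>
    obtain q0 where q0: "q0 \<in> v" "q0 \<noteq> y" "q0 \<noteq> z" "{y, q0} \<in> F" "{z, q0} \<in> F"
    proof (cases "t = {}")
      case True
      then show ?thesis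
        using that[of a] t(4,5) \<open>a \<noteq> z\<close> tF(4) XF(1)[unfolded az(3)] by (simp add: insert_commute)
    next
      case False
      obtain p where p: "p \<in> t" "{p} \<in> F" using step_up[of "{}" t] F tF False by blast
      \<comment> \<open>Even size shows \<open>t\<close> is not \<open>{p}\<close>, so a second step
        exists.\<close>
      have "even (card t)" using even_card_if_parallel_edge[of y t] F tF t by blast
      then have "{p} \<subset> t" using p(1) by auto
      then obtain q' where q': "q' \<in> t" "q' \<noteq> p" "{p, q'} \<in> F"
        using step_up[of "{p}" t] p tF by (auto simp: insert_commute)
      have "insert y t \<subset> v" "insert z t \<subset> v"
        using t \<open>y \<noteq> z\<close> less.prems(4,5) by auto
      then have "card (insert y t) < card v" "card (insert z t) < card v"
        using psubset_card_mono[OF \<open>finite v\<close>] by auto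
      then have "{y, q'} \<in> F" "{z, q'} \<in> F"
        using less.hyps[of "insert y t" F p y q'] less.hyps[of "insert z t" F p z q']
          hexagonal_family_axioms F tF p q' t(2,3) by blast+
      moreover have "q' \<in> v" "q' \<noteq> y" "q' \<noteq> z" using q'(1) t(1-3) by auto
      ultimately show ?thesis using that by blast
    qed
    show ?thesis
    proof (cases "q = q0")
      case False
      \<comment> \<open>Seen from \<open>{y}\<close>, both \<open>q0\<close> and \<open>q\<close>
        are directions, and \<open>z\<close> can follow \<open>q0\<close>. The induction hypothesis
        for the target \<open>v - {y}\<close> then lets \<open>z\<close> follow
        \<open>q\<close>.\<close>
      interpret T: hexagonal_family "(\<oplus>) {y} ` F" by (rule translate) simp
      have "{q0} \<notin> F" using no_square[of "{}" y q0] F q0 by auto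
      then have "{y, z, q0} \<in> F" using diamond_up[of y "{q0}" z] q0 \<open>y \<noteq> z\<close> by auto
      moreover have "{y} \<oplus> {q0} = {y, q0}" "{y} \<oplus> {q} = {y, q}" "{y} \<oplus> {q0, z} = {y, z, q0}"
        "{y} \<oplus> {q, z} = {y, z, q}" "{y} \<oplus> (v - {y}) = v"
        using q0(2) less.prems(4,10) \<open>y \<noteq> z\<close> by (auto simp: set_eq_iff)
      ultimately have "{} \<in> (\<oplus>) {y} ` F" "{q0} \<in> (\<oplus>) {y} ` F" "{q} \<in> (\<oplus>) {y} ` F"
        "{q0, z} \<in> (\<oplus>) {y} ` F" "v - {y} \<in> (\<oplus>) {y} ` F"
        unfolding mem_xor_image_iff using F q0 by simp_all
      moreover have "card (v - {y}) < card v" using \<open>finite v\<close> less.prems(4) by (rule card_Diff1_less)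
      ultimately have "{q, z} \<in> (\<oplus>) {y} ` F"
        using less.hyps[of "v - {y}" "(\<oplus>) {y} ` F" q0 q z] T.hexagonal_family_axioms
          less.prems(4-6,10,11) q0 \<open>y \<noteq> z\<close> by blast
      then have "{y, q, z} \<in> F"
        unfolding mem_xor_image_iff using \<open>{y} \<oplus> {q, z} = {y, z, q}\<close> by (simp add: insert_commute)
      \<comment> \<open>A step from \<open>{z}\<close> towards \<open>{y, q, z}\<close> must flip
        \<open>q\<close>, because \<open>{y, z}\<close> is not in the family.\<close>
      then show ?thesis
        using diamond_down[of y q "{z}"] yzF F less.prems(10,11) \<open>y \<noteq> z\<close> by (simp add: insert_commute)
    qed (use q0 in simp)
  qed (use less.prems in simp)
qed

context hexagonal_family
begin

lemma exchange:
  assumes "D \<in> F" "v \<in> F" "insert y (insert z (insert q D)) \<subseteq> v"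
    and "y \<notin> D" "z \<notin> D" "q \<notin> D" "q \<noteq> y" "q \<noteq> z"
    and "insert y D \<in> F" "insert z D \<in> F" "insert q (insert y D) \<in> F"
  shows "insert q (insert z D) \<in> F"
proof -
  interpret T: hexagonal_family "(\<oplus>) D ` F" by (rule translate[OF finite_member[OF assms(1)]])
  have eq: "D \<oplus> {y} = insert y D" "D \<oplus> {z} = insert z D" "D \<oplus> {y, q} = insert q (insert y D)"
    "D \<oplus> {z, q} = insert q (insert z D)" "D \<oplus> (v - D) = v"
    using assms(3-8) by (auto simp: set_eq_iff)
  then have "{} \<in> (\<oplus>) D ` F" "{y} \<in> (\<oplus>) D ` F" "{z} \<in> (\<oplus>) D ` F" "{y, q} \<in> (\<oplus>) D ` F"
    "v - D \<in> (\<oplus>) D ` F"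
    unfolding mem_xor_image_iff using assms by simp_all
  then have "{z, q} \<in> (\<oplus>) D ` F"
    by (intro exchange_from_empty[of "(\<oplus>) D ` F" "v - D" y z q])
      (use T.hexagonal_family_axioms assms(3-8) in auto)
  then show ?thesis unfolding mem_xor_image_iff using eq(4) by simp
qed

end

section \<open>Regular hexagonal families\<close>

text \<open>Subsets of equal size are connected by swaps: trading an element of \<open>A - B\<close>
  for one of \<open>B - A\<close> shrinks \<open>A - B\<close>, and \<open>step\<close> carries
  \<open>P\<close> across each swap, with \<open>D\<close> the common part.\<close>

lemma subset_exchange_induct:
  assumes "finite Y" "P A" "A \<subseteq> Y" "B \<subseteq> Y" "card A = card B"
    and step: "\<And>D y z. D \<subseteq> Y \<Longrightarrow> y \<in> Y - D \<Longrightarrow> z \<in> Y - D \<Longrightarrow> Suc (card D) = card B \<Longrightarrow>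
      P (insert y D) \<Longrightarrow> P (insert z D)"
  shows "P B"
  using assms(2,3,5)
proof (induction "card (A - B)" arbitrary: A rule: less_induct)
  case less
  have fin: "finite A" "finite B" using less.prems assms finite_subset by blast+
  show ?case
  proof (cases "A = B")
    case False
    then obtain y z where y: "y \<in> A" "y \<notin> B" and z: "z \<in> B" "z \<notin> A"
      using less.prems fin by (metis card_subset_eq subsetI)
    define D where "D = A - {y}"
    have A: "A = insert y D" "y \<notin> D" using y by (auto simp: D_def)
    have D: "D \<subseteq> Y" "z \<notin> D" "finite D" using less.prems fin z by (auto simp: D_def)
    have "card A = Suc (card D)" using A D by simp
    then have "P (insert z D)"
      using step[of D y z] A D less.prems y z assms(4) by auto
    moreover have "insert z D - B = (A - B) - {y}" using z by (auto simp: D_def)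
    then have "card (insert z D - B) < card (A - B)"
      using y fin(1) card_Diff1_less[of "A - B" y] by simp
    moreover have "insert z D \<subseteq> Y" "card (insert z D) = card B"
      using D z assms(4) \<open>card A = Suc (card D)\<close> less.prems by auto
    ultimately show ?thesis using less.hyps[of "insert z D"] by blast
  qed (use less.prems in simp)
qed

lemma card_eq_Suc_SucE:
  assumes "card A = Suc (Suc n)"
  obtains x y D where "A = insert x (insert y D)" "x \<noteq> y" "x \<notin> D" "y \<notin> D" "card D = n" "finite D"
proof -
  obtain x B where x: "A = insert x B" "x \<notin> B" "card B = Suc n"
    using assms card_Suc_eq[of A "Suc n"] by blast
  obtain y D where y: "B = insert y D" "y \<notin> D" "card D = n"
    using x(3) card_Suc_eq[of B n] by blast
  have "finite A" using assms card.infinite by fastforce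
  then show ?thesis using that[of x y D] x y by auto
qed

section \<open>Edge directions, regularity and layers towards an antipode\<close>

definition dirs :: "'e set set \<Rightarrow> 'e set \<Rightarrow> 'e set" where
  "dirs F A = {e. A \<oplus> {e} \<in> F}"

lemma in_dirs_empty_iff [simp]: "e \<in> dirs F {} \<longleftrightarrow> {e} \<in> F"
  by (simp add: dirs_def)

lemma in_dirs_iff: "e \<in> dirs F A \<longleftrightarrow> (if e \<in> A then A - {e} else insert e A) \<in> F"
proof -
  have "A \<oplus> {e} = (if e \<in> A then A - {e} else insert e A)" by (auto simp: set_eq_iff)
  then show ?thesis by (simp add: dirs_def)
qed

lemma dirs_translate: "dirs ((\<oplus>) D ` F) A = dirs F (D \<oplus> A)"
  by (simp add: dirs_def mem_xor_image_iff xor_assoc)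

text \<open>Regularity is expressed through edge labels. Since infinite sets have cardinality 0,
  \<open>d_pos\<close> also makes every \<open>dirs F A\<close> with \<open>A\<close> in
  \<open>F\<close> finite.\<close>

locale regular_hexagonal_family = hexagonal_family +
  fixes d :: nat
  assumes finite_family: "finite F"
    and card_dirs: "A \<in> F \<Longrightarrow> card (dirs F A) = d"
    and d_pos: "0 < d"
begin

lemma translate_regular: "finite D \<Longrightarrow> regular_hexagonal_family ((\<oplus>) D ` F) d"
  using translate[of D] finite_family card_dirs d_pos
  by (auto simp: regular_hexagonal_family_def regular_hexagonal_family_axioms_def
      dirs_translate mem_xor_image_iff)

lemma finite_dirs: "A \<in> F \<Longrightarrow> finite (dirs F A)"
  using card_dirs d_pos card_gt_0_iff by metis

text \<open>In each layer one set \<open>Q\<close> serves for all subsets \<open>Y'\<close> at once.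
  The next layer adds a single element \<open>q\<close>, found by one step towards \<open>v\<close>
  and spread to the other subsets by exchange.\<close>

lemma layers:
  assumes "{} \<in> F" "v \<in> F" "dirs F {} \<subseteq> v" "i < d"
  shows "\<exists>Q. Q \<subseteq> v - dirs F {} \<and> card Q = i \<and>
    (\<forall>Y'\<subseteq>dirs F {}. card Y' = i \<or> card Y' = Suc i \<longrightarrow> Y' \<union> Q \<in> F)"
  using assms(4)
proof (induction i)
  case 0
  have "Y' \<in> F" if "Y' \<subseteq> dirs F {}" "card Y' = 0 \<or> card Y' = Suc 0" for Y'
  proof -
    have "finite Y'" using that(1) finite_dirs[OF assms(1)] finite_subset by blast
    then show ?thesis using that assms(1) by (auto simp: card_1_singleton_iff)
  qed
  then show ?case by (intro exI[of _ "{}"]) auto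
next
  case (Suc i)
  let ?Y = "dirs F {}"
  have finY: "finite ?Y" using finite_dirs assms by blast
  have cardY: "card ?Y = d" using card_dirs assms by blast
  have finv: "finite v" using finite_member assms by blast
  obtain Q where Q: "Q \<subseteq> v - ?Y" "card Q = i"
    "\<And>Y'. Y' \<subseteq> ?Y \<Longrightarrow> card Y' = i \<or> card Y' = Suc i \<Longrightarrow> Y' \<union> Q \<in> F"
    using Suc by auto
  have finQ: "finite Q" using Q finv finite_subset by blast
  obtain Y0 where Y0: "Y0 \<subseteq> ?Y" "card Y0 = Suc i"
    using obtain_subset_with_card_n[of "Suc i" ?Y] cardY Suc.prems by auto
  have finY0: "finite Y0" using Y0 finY finite_subset by blast
  have "Y0 \<noteq> ?Y" using Y0 cardY Suc.prems by auto
  then have "Y0 \<union> Q \<subset> v" using Y0(1) Q(1) assms(3) by blast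
  then obtain q where q: "q \<in> v - (Y0 \<union> Q)" "insert q (Y0 \<union> Q) \<in> F"
    using step_up[of "Y0 \<union> Q" v] Q(3) Y0 assms(2) by blast
  \<comment> \<open>A direction of the empty set can recur only at a set of even size, but
    \<open>Y0 \<union> Q\<close> has \<open>2i + 1\<close> elements.\<close>
  have "q \<notin> ?Y"
  proof
    assume "q \<in> ?Y"
    then have "even (card (Y0 \<union> Q))"
      using even_card_if_parallel_edge[of q "Y0 \<union> Q"] q Q(3) Y0 assms(1) by auto
    moreover have "card (Y0 \<union> Q) = Suc i + i"
      using card_Un_disjoint[of Y0 Q] finY0 finQ Y0 Q(1,2) by auto
    ultimately show False by simp
  qed
  have small: "Y' \<union> insert q Q \<in> F" if Y': "Y' \<subseteq> ?Y" "card Y' = Suc i" for Y'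
  proof (rule subset_exchange_induct[where A = Y0 and P = "\<lambda>B. B \<union> insert q Q \<in> F", OF finY])
    fix D y z assume D: "D \<subseteq> ?Y" "y \<in> ?Y - D" "z \<in> ?Y - D" "Suc (card D) = card Y'"
      and y: "insert y D \<union> insert q Q \<in> F"
    have "finite D" using D(1) finY finite_subset by blast
    then have DF: "D \<union> Q \<in> F" "insert y D \<union> Q \<in> F" "insert z D \<union> Q \<in> F"
      using Q(3)[of D] Q(3)[of "insert y D"] Q(3)[of "insert z D"] D Y' by auto
    have sub: "y \<notin> D \<union> Q" "z \<notin> D \<union> Q" "q \<notin> D \<union> Q" "q \<noteq> y" "q \<noteq> z"
      "insert y (insert z (insert q (D \<union> Q))) \<subseteq> v"
      using D(1-3) Q(1) \<open>q \<notin> ?Y\<close> q(1) assms(3) by blast+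
    have "insert q (insert z (D \<union> Q)) \<in> F"
      using exchange[OF DF(1) assms(2) sub(6) sub(1-5)] DF y by (simp add: insert_commute)
    then show "insert z D \<union> insert q Q \<in> F" by (simp add: insert_commute)
  qed (use q Y0 Y' in auto)
  have large: "Y' \<union> insert q Q \<in> F" if Y': "Y' \<subseteq> ?Y" "card Y' = Suc (Suc i)" for Y'
  proof -
    obtain y z D where D: "Y' = insert y (insert z D)" "y \<noteq> z" "y \<notin> D" "z \<notin> D" "card D = i" "finite D"
      using Y'(2) by (elim card_eq_Suc_SucE)
    have yF: "insert y (insert q (D \<union> Q)) \<in> F" "insert z (insert q (D \<union> Q)) \<in> F"
      using small[of "insert y D"] small[of "insert z D"] D Y'(1) by (auto simp: insert_commute)
    have notin: "y \<notin> insert q (D \<union> Q)" "z \<notin> insert q (D \<union> Q)" "q \<notin> D \<union> Q" "y \<noteq> z"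
      using D Y'(1) Q(1) \<open>q \<notin> ?Y\<close> q(1) by auto
    have DF: "D \<union> Q \<in> F" "insert y (D \<union> Q) \<in> F"
      using Q(3)[of D] Q(3)[of "insert y D"] D Y'(1) by auto
    \<comment> \<open>This corner would complete a square with base \<open>D \<union> Q\<close>. Its
      absence forces the two sets in \<open>yF\<close> to have their common neighbour above.\<close>
    have "insert q (D \<union> Q) \<notin> F"
      using no_square[OF DF(1,2) _ yF(1)] notin by auto
    then have "insert y (insert z (insert q (D \<union> Q))) \<in> F"
      using diamond_up[of y "insert q (D \<union> Q)" z] yF notin by blast
    then show ?thesis using D(1) by (simp add: insert_commute)
  qed
  have "card (insert q Q) = Suc i" using Q(2) q finQ by simp
  moreover have "insert q Q \<subseteq> v - ?Y" using Q(1) q \<open>q \<notin> ?Y\<close> by auto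
  ultimately show ?case using small large by (intro exI[of _ "insert q Q"]) auto
qed

text \<open>In the top layer, \<open>W\<close> has \<open>d\<close> neighbours obtained by removing
  one element of \<open>dirs F {}\<close>. Regularity leaves no further edge, in particular none
  upwards to \<open>v\<close>, so \<open>W\<close> is \<open>v\<close>.\<close>

lemma dirs_antipode_of_empty:
  assumes "{} \<in> F" "v \<in> F" "dirs F {} \<subseteq> v"
  shows "dirs F v = dirs F {}" "card v = 2 * d - 1"
proof -
  let ?Y = "dirs F {}"
  have finY: "finite ?Y" using finite_dirs assms by blast
  have cardY: "card ?Y = d" using card_dirs assms by blast
  obtain Q where Q: "Q \<subseteq> v - ?Y" "card Q = d - 1"
    "\<And>Y'. Y' \<subseteq> ?Y \<Longrightarrow> card Y' = d - 1 \<or> card Y' = Suc (d - 1) \<Longrightarrow> Y' \<union> Q \<in> F"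
    using layers[OF assms, of "d - 1"] d_pos by auto
  have finQ: "finite Q" using Q finite_member[OF assms(2)] finite_subset by blast
  define W where "W = ?Y \<union> Q"
  have WF: "W \<in> F" using Q(3)[of ?Y] cardY d_pos by (simp add: W_def)
  have "?Y \<subseteq> dirs F W"
  proof
    fix y assume y: "y \<in> ?Y"
    then have "(?Y - {y}) \<union> Q \<in> F" using Q(3)[of "?Y - {y}"] cardY finY by auto
    moreover have "(?Y - {y}) \<union> Q = W - {y}" using Q(1) y by (auto simp: W_def)
    ultimately show "y \<in> dirs F W" using y by (simp add: in_dirs_iff W_def)
  qed
  then have dirsW: "dirs F W = ?Y"
    using card_subset_eq[OF finite_dirs[OF WF]] cardY card_dirs[OF WF] by auto
  have "W = v"
  proof (rule ccontr)
    assume "W \<noteq> v"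
    then have "W \<subset> v" using Q(1) assms(3) by (auto simp: W_def)
    then obtain q where "q \<in> v - W" "insert q W \<in> F" using step_up WF assms(2) by blast
    then have "q \<in> dirs F W" "q \<notin> W" by (auto simp: in_dirs_iff)
    then show False using dirsW by (simp add: W_def)
  qed
  then show "dirs F v = ?Y" using dirsW by simp
  have "card W = d + (d - 1)"
    using card_Un_disjoint[OF finY finQ] Q(1,2) cardY by (auto simp: W_def)
  then show "card v = 2 * d - 1" using \<open>W = v\<close> d_pos by simp
qed

lemma dirs_antipode:
  assumes "C \<in> F" "v \<in> F" "dirs F C \<subseteq> C \<oplus> v"
  shows "dirs F v = dirs F C"
proof -
  interpret T: regular_hexagonal_family "(\<oplus>) C ` F" d
    by (rule translate_regular[OF finite_member[OF assms(1)]])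
  show ?thesis
    using T.dirs_antipode_of_empty(1)[of "C \<oplus> v"] assms by (simp add: mem_xor_image_iff dirs_translate)
qed

end

section \<open>An extremal vertex determines the family\<close>

lemma card_xor_singleton:
  "finite A \<Longrightarrow> card (A \<oplus> {e}) = (if e \<in> A then card A - 1 else Suc (card A))"
  by (simp add: xor_subset xor_disjoint)

context regular_hexagonal_family
begin

text \<open>By \<open>far\<close>, the empty set is farthest from \<open>v\<close>, so all its edges
  lead towards \<open>v\<close>. At \<open>{y}\<close>, every direction other than \<open>y\<close>
  is confined to \<open>v - dirs F {}\<close>, and counting turns this inclusion into
  equality.\<close>

lemma second_layer:
  assumes "{} \<in> F" "v \<in> F" and far: "\<And>X. X \<in> F \<Longrightarrow> card (X \<oplus> v) \<le> card v"
    and y: "y \<in> dirs F {}"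
  shows "dirs F {} \<subseteq> v" "dirs F {y} = insert y (v - dirs F {})"
proof -
  have finv: "finite v" using finite_member assms(2) by blast
  show Yv: "dirs F {} \<subseteq> v"
  proof (rule subsetI, rule ccontr)
    fix e assume "e \<in> dirs F {}" "e \<notin> v"
    then show False using far[of "{e}"] card_xor_singleton[OF finv, of e] by (simp add: xor_commute)
  qed
  note antipode = dirs_antipode_of_empty[OF assms(1,2) Yv]
  have yF: "{y} \<in> F" using y by simp
  have "q \<in> v - dirs F {}" if q: "q \<in> dirs F {y}" "q \<noteq> y" for q
  proof -
    have yq: "{y, q} \<in> F" using q by (simp add: in_dirs_iff insert_commute)
    \<comment> \<open>If \<open>q\<close> is outside \<open>v\<close>, then \<open>{y, q}\<close> is
      as far from \<open>v\<close> as the empty set, hence also extremal, and it shares the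
      directions of \<open>v\<close>. The edge back to \<open>{y}\<close> then puts \<open>q\<close>
      among them, although they all lie in \<open>v\<close>.\<close>
    have "q \<in> v"
    proof (rule ccontr)
      assume "q \<notin> v"
      have "y \<in> v" using Yv y by blast
      have eq: "{y, q} \<oplus> v = insert q (v - {y})"
        using \<open>q \<notin> v\<close> \<open>y \<in> v\<close> by (auto simp: set_eq_iff)
      have card: "card ({y, q} \<oplus> v) = card v"
        unfolding eq using finv \<open>y \<in> v\<close> \<open>q \<notin> v\<close> card_Suc_Diff1[of v y] by simp
      have "dirs F {y, q} \<subseteq> {y, q} \<oplus> v"
      proof (rule subsetI, rule ccontr)
        fix e assume e: "e \<in> dirs F {y, q}" "e \<notin> {y, q} \<oplus> v"
        have "card ({y, q} \<oplus> {e} \<oplus> v) = card ({y, q} \<oplus> v \<oplus> {e})"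
          by (metis xor_assoc xor_commute)
        also have "\<dots> = Suc (card v)" using card_xor_singleton[of "{y, q} \<oplus> v" e] e(2) card finv by simp
        finally show False using far[of "{y, q} \<oplus> {e}"] e(1) by (simp add: dirs_def)
      qed
      then have "dirs F {y, q} = dirs F {}" using dirs_antipode[OF yq assms(2)] antipode by simp
      moreover have "q \<in> dirs F {y, q}" using yF q(2) by (simp add: in_dirs_iff insert_Diff_if)
      ultimately show False using Yv \<open>q \<notin> v\<close> by blast
    qed
    moreover have "q \<notin> dirs F {}"
      using no_square[of "{}" y q] assms(1) yF yq q(2) by auto
    ultimately show ?thesis by blast
  qed
  then have sub: "dirs F {y} \<subseteq> insert y (v - dirs F {})" by blast
  have "card (v - dirs F {}) = d - 1"
    using card_Diff_subset[OF finite_dirs[OF assms(1)] Yv] antipode(2) card_dirs[OF assms(1)] by simp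
  then have "card (insert y (v - dirs F {})) = d" using finv y d_pos by simp
  then show "dirs F {y} = insert y (v - dirs F {})"
    using card_subset_eq[OF _ sub] finv card_dirs[OF yF] by simp
qed

text \<open>Smaller balanced sets supply two neighbours of the wanted set or of its corners,
  \<open>no_square\<close> excludes the corner below, and \<open>diamond_up\<close> yields the set
  itself. The case of one element on each side comes from \<open>second\<close>.\<close>

lemma balanced_sets_in_family:
  assumes "{} \<in> F" "dirs F {} \<subseteq> v"
    and second: "\<And>y. y \<in> dirs F {} \<Longrightarrow> dirs F {y} = insert y (v - dirs F {})"
    and "finite v"
    and "Q' \<subseteq> v - dirs F {}" "Y' \<subseteq> dirs F {}" "card Y' = card Q' \<or> card Y' = Suc (card Q')"
  shows "Y' \<union> Q' \<in> F"
  using assms(5-7)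
proof (induction "card Q'" arbitrary: Y' Q' rule: less_induct)
  case less
  let ?Y = "dirs F {}"
  have finY: "finite ?Y" using finite_dirs assms by blast
  have fin: "finite Q'" "finite Y'" using less.prems finY \<open>finite v\<close> finite_subset by blast+
  have IH: "A \<union> B \<in> F" if "B \<subseteq> v - ?Y" "A \<subseteq> ?Y" "card B < card Q'" "card A = card B \<or> card A = Suc (card B)" for A B
    using less.hyps that by blast
  have small: "Y1 \<union> Q' \<in> F" if Y1: "Y1 \<subseteq> ?Y" "card Y1 = card Q'" "Y1 \<noteq> {}" for Y1
  proof -
    have finY1: "finite Y1" using Y1(1) finY finite_subset by blast
    obtain y B1 where y: "Y1 = insert y B1" "y \<notin> B1" using Y1(3) by (meson Set.set_insert ex_in_conv)
    have cB: "card Q' = Suc (card B1)" "finite B1" using y finY1 Y1(2) by auto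
    show ?thesis
    proof (cases "card B1")
      case 0
      then have "B1 = {}" using cB(2) by simp
      have "card Q' = Suc 0" using cB 0 by simp
      then obtain q where q: "Q' = {q}" by (auto simp: card_1_singleton_iff)
      have "q \<in> v - ?Y" "y \<in> ?Y" using less.prems(1) q Y1(1) y by auto
      then have "q \<in> dirs F {y}" "q \<noteq> y" using second[of y] by auto
      then show ?thesis using y q \<open>B1 = {}\<close> by (simp add: in_dirs_iff insert_commute)
    next
      case (Suc n)
      then have "card Q' = Suc (Suc n)" using cB by simp
      then obtain q q' R where R: "Q' = insert q (insert q' R)" "q \<noteq> q'" "q \<notin> R" "q' \<notin> R"
        "card R = n" "finite R"
        by (elim card_eq_Suc_SucE)
      have cY1: "card Y1 = Suc (Suc n)" using \<open>card Q' = Suc (Suc n)\<close> Y1(2) by simp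
      have sub: "R \<subseteq> v - ?Y" "q \<in> v - ?Y" "q' \<in> v - ?Y" "B1 \<subseteq> ?Y" "y \<in> ?Y"
        using less.prems(1) R(1) Y1(1) y(1) by auto
      have qX: "insert q (Y1 \<union> R) \<in> F" "insert q' (Y1 \<union> R) \<in> F"
        using IH[of "insert q R" Y1] IH[of "insert q' R" Y1] sub R cY1 Y1(1) by auto
      have B: "B1 \<union> R \<in> F" "insert q (B1 \<union> R) \<in> F"
        using IH[of R B1] IH[of "insert q R" B1] sub R Suc by auto
      have notin: "y \<notin> B1 \<union> R" "q \<notin> Y1 \<union> R" "q' \<notin> Y1 \<union> R" "q \<noteq> y"
        using y(2) sub R(2-4) Y1(1) by auto
      have "Y1 \<union> R \<notin> F"
        using no_square[OF B(1), of y q] B(2) qX(1) y(1) notin by (auto simp: insert_commute)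
      then have "insert q (insert q' (Y1 \<union> R)) \<in> F"
        using diamond_up[of q "Y1 \<union> R" q'] qX R(2) notin by blast
      then show ?thesis using R(1) by simp
    qed
  qed
  show ?case
  proof (cases "Q' = {}")
    case True
    then show ?thesis using less.prems(2,3) fin assms(1) by (auto simp: card_1_singleton_iff)
  next
    case False
    show ?thesis
    proof (cases "card Y' = card Q'")
      case True
      moreover have "Y' \<noteq> {}" using True False fin by auto
      ultimately show ?thesis using small[of Y'] less.prems(2) by blast
    next
      case False
      obtain q R where q: "Q' = insert q R" "q \<notin> R" using \<open>Q' \<noteq> {}\<close> by (meson Set.set_insert ex_in_conv)
      then have cR: "card Q' = Suc (card R)" "finite R" using fin by auto
      then have "card Y' = Suc (Suc (card R))" using False less.prems(3) by simp
      then obtain y z D where D: "Y' = insert y (insert z D)" "y \<noteq> z" "y \<notin> D" "z \<notin> D"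
        "card D = card R" "finite D"
        by (elim card_eq_Suc_SucE)
      have sub: "R \<subseteq> v - ?Y" "q \<in> v - ?Y" "D \<subseteq> ?Y" "y \<in> ?Y" "z \<in> ?Y"
        using less.prems(1,2) q(1) D(1) by auto
      have yF: "insert y (D \<union> Q') \<in> F" "insert z (D \<union> Q') \<in> F"
        using small[of "insert y D"] small[of "insert z D"] D sub cR by auto
      have B: "D \<union> R \<in> F" "insert y (D \<union> R) \<in> F"
        using IH[of R D] IH[of R "insert y D"] sub D cR by auto
      have notin: "y \<notin> D \<union> Q'" "z \<notin> D \<union> Q'" "q \<notin> D \<union> R" "q \<noteq> y"
        using sub q D(3,4) by auto
      have "D \<union> Q' \<notin> F"
        using no_square[OF B, of q] yF(1) notin q(1) by auto
      then have "insert y (insert z (D \<union> Q')) \<in> F"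
        using diamond_up[of y "D \<union> Q'" z] yF D(2) notin by blast
      then show ?thesis using D(1) by simp
    qed
  qed
qed

text \<open>All balanced sets belong to \<open>F\<close>, and each of them has \<open>d\<close>
  balanced neighbours. Regularity leaves no edge from a balanced set to anything else, and
  \<open>F\<close> is connected.\<close>

lemma family_eq_balanced_sets:
  assumes "{} \<in> F" "v \<in> F" and far: "\<And>X. X \<in> F \<Longrightarrow> card (X \<oplus> v) \<le> card v"
  defines "Y \<equiv> dirs F {}"
  defines "Q \<equiv> v - Y"
  shows "F = {X. X \<subseteq> v \<and> (card (X \<inter> Y) = card (X \<inter> Q) \<or> card (X \<inter> Y) = Suc (card (X \<inter> Q)))}"
    (is "F = ?G")
proof
  have finY: "finite Y" and cardY: "card Y = d" using finite_dirs card_dirs assms(1) by (auto simp: Y_def)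
  then obtain y0 where y0: "y0 \<in> dirs F {}" using d_pos by (metis Y_def card_gt_0_iff ex_in_conv)
  have Yv: "Y \<subseteq> v" using second_layer(1)[OF assms(1-3) y0] by (simp add: Y_def)
  have finv: "finite v" using finite_member assms(2) by blast
  have cardQ: "card Q = d - 1"
    using card_Diff_subset[OF finY Yv] dirs_antipode_of_empty(2)[OF assms(1,2)] Yv cardY
    by (simp add: Y_def Q_def)
  have finQ: "finite Q" using finv by (simp add: Q_def)
  show GF: "?G \<subseteq> F"
  proof
    fix X assume X: "X \<in> ?G"
    then have "(X \<inter> Y) \<union> (X \<inter> Q) \<in> F"
      using balanced_sets_in_family[of v "X \<inter> Q" "X \<inter> Y"] second_layer(2)[OF assms(1-3)] assms(1) Yv finv
      by (auto simp: Y_def Q_def)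
    moreover have "(X \<inter> Y) \<union> (X \<inter> Q) = X" using X by (auto simp: Q_def)
    ultimately show "X \<in> F" by simp
  qed
  have closed: "insert e W \<in> ?G" if W: "W \<in> ?G" and e: "e \<notin> W" "insert e W \<in> F" for W e
  proof -
    \<comment> \<open>\<open>M\<close> collects the flips that preserve balance: with equal counts,
      add an element of \<open>Y\<close> or drop one of \<open>Q\<close>; otherwise drop one of
      \<open>Y\<close> or add one of \<open>Q\<close>. Either way there are \<open>d\<close> of
      them.\<close>
    define M where "M = (if card (W \<inter> Y) = card (W \<inter> Q) then (Y - W) \<union> (W \<inter> Q) else (W \<inter> Y) \<union> (Q - W))"
    have WF: "W \<in> F" and Wv: "W \<subseteq> v" using GF W by auto
    have finW: "finite W" using WF finite_member by blast
    have cards: "card (Y - W) + card (W \<inter> Y) = d" "card (Q - W) + card (W \<inter> Q) = d - 1"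
      using card_Int_Diff[OF finY, of W] card_Int_Diff[OF finQ, of W] cardY cardQ
      by (simp_all add: Int_commute)
    have YQ: "Y \<inter> Q = {}" by (auto simp: Q_def)
    have "card M = d"
    proof (cases "card (W \<inter> Y) = card (W \<inter> Q)")
      case True
      then have "card M = card (Y - W) + card (W \<inter> Q)"
        using card_Un_disjoint[of "Y - W" "W \<inter> Q"] finY finW by (auto simp: M_def)
      then show ?thesis using True cards by simp
    next
      case False
      then have "card M = card (W \<inter> Y) + card (Q - W)"
        using card_Un_disjoint[of "W \<inter> Y" "Q - W"] finQ finW by (auto simp: M_def)
      then show ?thesis using False W cards d_pos by auto
    qed
    have MG: "W \<oplus> {m} \<in> ?G" if m: "m \<in> M" for m
    proof -
      have "m \<in> v" using m Yv by (auto simp: M_def Q_def split: if_splits)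
      then have "W \<oplus> {m} \<subseteq> v" using Wv by auto
      have "(m \<in> Y \<and> m \<notin> Q) \<or> (m \<in> Q \<and> m \<notin> Y)" using m YQ by (auto simp: M_def split: if_splits)
      then show ?thesis
      proof (elim disjE conjE)
        assume mY: "m \<in> Y" "m \<notin> Q"
        have Q: "(W \<oplus> {m}) \<inter> Q = W \<inter> Q" using mY by auto
        show ?thesis
        proof (cases "m \<in> W")
          case True
          then have "card (W \<inter> Y) \<noteq> card (W \<inter> Q)" using m mY by (auto simp: M_def split: if_splits)
          then have "card (W \<inter> Y) = Suc (card (W \<inter> Q))" using W by auto
          moreover have "(W \<oplus> {m}) \<inter> Y = (W \<inter> Y) - {m}" using True by auto
          ultimately show ?thesis using Q \<open>W \<oplus> {m} \<subseteq> v\<close> mY True finW by simp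
        next
          case False
          then have "card (W \<inter> Y) = card (W \<inter> Q)" using m mY by (auto simp: M_def split: if_splits)
          moreover have "(W \<oplus> {m}) \<inter> Y = insert m (W \<inter> Y)" using False mY by auto
          ultimately show ?thesis using Q \<open>W \<oplus> {m} \<subseteq> v\<close> False finW by simp
        qed
      next
        assume mQ: "m \<in> Q" "m \<notin> Y"
        have Y: "(W \<oplus> {m}) \<inter> Y = W \<inter> Y" using mQ by auto
        show ?thesis
        proof (cases "m \<in> W")
          case True
          then have "card (W \<inter> Y) = card (W \<inter> Q)" using m mQ by (auto simp: M_def split: if_splits)
          moreover have "(W \<oplus> {m}) \<inter> Q = (W \<inter> Q) - {m}" using True by auto
          moreover have "card (W \<inter> Q) = Suc (card (W \<inter> Q - {m}))"
            using card.remove[of "W \<inter> Q" m] True mQ finW by simp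
          ultimately show ?thesis using Y \<open>W \<oplus> {m} \<subseteq> v\<close> by simp
        next
          case False
          then have "card (W \<inter> Y) \<noteq> card (W \<inter> Q)" using m mQ by (auto simp: M_def split: if_splits)
          then have "card (W \<inter> Y) = Suc (card (W \<inter> Q))" using W by auto
          moreover have "(W \<oplus> {m}) \<inter> Q = insert m (W \<inter> Q)" using False mQ by auto
          ultimately show ?thesis using Y \<open>W \<oplus> {m} \<subseteq> v\<close> False finW by simp
        qed
      qed
    qed
    then have "M \<subseteq> dirs F W" unfolding dirs_def using GF by blast
    then have "M = dirs F W"
      using card_subset_eq[OF finite_dirs[OF WF]] card_dirs[OF WF] \<open>card M = d\<close> by simp
    then have "e \<in> M" using e by (simp add: in_dirs_iff)
    then have "W \<oplus> {e} \<in> ?G" by (rule MG)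
    then show ?thesis using e by (simp add: xor_disjoint)
  qed
  \<comment> \<open>Each member descends to the empty set one element at a time, and
    \<open>closed\<close> climbs back up.\<close>
  show "F \<subseteq> ?G"
  proof
    fix X assume "X \<in> F"
    then show "X \<in> ?G"
    proof (induction "card X" arbitrary: X rule: less_induct)
      case less
      show ?case
      proof (cases "X = {}")
        case False
        then obtain e where e: "e \<in> X" "X - {e} \<in> F" using step_down[of "{}" X] less.prems assms(1) by blast
        have "card (X - {e}) < card X" using finite_member less.prems e by (meson card_Diff1_less)
        then have "X - {e} \<in> ?G" using less.hyps e(2) by blast
        then have "insert e (X - {e}) \<in> ?G"
          using closed[of "X - {e}" e] e(1) less.prems by (simp add: insert_absorb)
        then show ?thesis using e(1) by (simp add: insert_absorb)
      qed simp
    qed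
  qed
qed

text \<open>A member \<open>C\<close> farthest from \<open>v\<close> is moved to the empty set.
  Flipping \<open>Y\<close> then sends a balanced \<open>X\<close> to a set of size
  \<open>d - card (X \<inter> Y) + card (X - Y)\<close>, which is \<open>d\<close> or
  \<open>d - 1\<close>.\<close>

theorem family_eq_middle_layers:
  assumes "F \<noteq> {}"
  shows "\<exists>S v. finite v \<and> card v = 2 * d - 1 \<and>
    (\<oplus>) S ` F = {Z. Z \<subseteq> v \<and> (card Z = d - 1 \<or> card Z = d)}"
proof -
  obtain v where v: "v \<in> F" using assms by blast
  have "Max ((\<lambda>X. card (X \<oplus> v)) ` F) \<in> (\<lambda>X. card (X \<oplus> v)) ` F"
    using finite_family assms by (intro Max_in) auto
  then obtain C where C: "C \<in> F" "\<And>X. X \<in> F \<Longrightarrow> card (X \<oplus> v) \<le> card (C \<oplus> v)"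
    using finite_family by (metis (no_types, lifting) Max_ge finite_imageI image_eqI image_iff)
  interpret T: regular_hexagonal_family "(\<oplus>) C ` F" d
    by (rule translate_regular[OF finite_member[OF C(1)]])
  let ?F = "(\<oplus>) C ` F"
  define w where "w = C \<oplus> v"
  define Y where "Y = dirs ?F {}"
  have base: "{} \<in> ?F" "w \<in> ?F" using C(1) v by (auto simp: mem_xor_image_iff w_def)
  have far: "card (X \<oplus> w) \<le> card w" if "X \<in> ?F" for X
    using C(2)[of "C \<oplus> X"] that unfolding mem_xor_image_iff w_def
    by (simp add: xor_assoc) (metis xor_assoc xor_commute)
  have finY: "finite Y" "card Y = d" using T.finite_dirs T.card_dirs base by (auto simp: Y_def)
  then obtain y0 where "y0 \<in> dirs ?F {}" using d_pos by (metis Y_def card_gt_0_iff ex_in_conv)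
  then have Yw: "Y \<subseteq> w" using T.second_layer(1)[OF base far] by (simp add: Y_def)
  have finw: "finite w" using T.finite_member base by blast
  have F: "?F = {X. X \<subseteq> w \<and> (card (X \<inter> Y) = card (X \<inter> (w - Y)) \<or> card (X \<inter> Y) = Suc (card (X \<inter> (w - Y))))}"
    unfolding Y_def by (rule T.family_eq_balanced_sets[OF base far])
  have iff: "Y \<oplus> Z \<in> ?F \<longleftrightarrow> Z \<subseteq> w \<and> (card Z = d - 1 \<or> card Z = d)" for Z
  proof (cases "Z \<subseteq> w")
    case True
    have finZ: "finite Z" using True finw finite_subset by blast
    have "(Y \<oplus> Z) \<inter> Y = Y - Z" "(Y \<oplus> Z) \<inter> (w - Y) = Z - Y" "Y \<oplus> Z \<subseteq> w" using True Yw by auto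
    moreover have "card (Y - Z) + card (Y \<inter> Z) = d" "card Z = card (Y \<inter> Z) + card (Z - Y)"
      using card_Int_Diff[OF finY(1), of Z] card_Int_Diff[OF finZ, of Y] finY(2)
      by (simp_all add: Int_commute)
    ultimately show ?thesis using True d_pos unfolding F by auto
  next
    case False
    then obtain x where "x \<in> Z" "x \<notin> w" by blast
    then have "x \<in> Y \<oplus> Z" using Yw by auto
    then have "\<not> Y \<oplus> Z \<subseteq> w" using \<open>x \<notin> w\<close> by blast
    then show ?thesis using False unfolding F by simp
  qed
  have "(\<oplus>) (C \<oplus> Y) ` F = {Z. Z \<subseteq> w \<and> (card Z = d - 1 \<or> card Z = d)}"
  proof (rule set_eqI)
    fix Z
    show "Z \<in> (\<oplus>) (C \<oplus> Y) ` F \<longleftrightarrow> Z \<in> {Z. Z \<subseteq> w \<and> (card Z = d - 1 \<or> card Z = d)}"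
      using iff[of Z] unfolding mem_xor_image_iff xor_assoc by simp
  qed
  moreover have "card w = 2 * d - 1"
    using T.dirs_antipode_of_empty(2)[OF base] Yw by (simp add: Y_def)
  ultimately show ?thesis using finw by blast
qed

end

section \<open>Graphs labelled by sets\<close>

lemma card_xor_triangle:
  assumes "finite A" "finite B" "finite C"
  shows "card (A \<oplus> C) \<le> card (A \<oplus> B) + card (B \<oplus> C)"
proof -
  have "card (A \<oplus> C) \<le> card ((A \<oplus> B) \<union> (B \<oplus> C))"
    using assms by (intro card_mono) auto
  then show ?thesis using card_Un_le le_trans by blast
qed

text \<open>Equality in the triangle inequality forces \<open>A \<oplus> B\<close> and
  \<open>B \<oplus> C\<close> to be disjoint, so their union is \<open>A \<oplus> C\<close>.\<close>

lemma xor_subset_if_between: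
  assumes "finite A" "finite B" "finite C" "card (A \<oplus> B) + card (B \<oplus> C) \<le> card (A \<oplus> C)"
  shows "A \<oplus> B \<subseteq> A \<oplus> C"
proof -
  have fin: "finite (A \<oplus> B)" "finite (B \<oplus> C)" using assms by auto
  have "card (A \<oplus> C) \<le> card ((A \<oplus> B) \<union> (B \<oplus> C) - (A \<oplus> B) \<inter> (B \<oplus> C))"
    using assms by (intro card_mono) auto
  also have "\<dots> = card ((A \<oplus> B) \<union> (B \<oplus> C)) - card ((A \<oplus> B) \<inter> (B \<oplus> C))"
    using fin by (intro card_Diff_subset) auto
  finally have "card ((A \<oplus> B) \<inter> (B \<oplus> C)) = 0"
    using card_Un_Int[OF fin] assms(4) by linarith
  then have "(A \<oplus> B) \<inter> (B \<oplus> C) = {}" using fin by simp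
  then show ?thesis by auto
qed

lemma card_xor_eq_1_iff: "card (A \<oplus> B) = 1 \<longleftrightarrow> (\<exists>e. B = A \<oplus> {e})"
proof -
  have "A \<oplus> B = {e} \<longleftrightarrow> B = A \<oplus> {e}" for e by (metis xor_cancel)
  then show ?thesis by (simp add: card_1_singleton_iff)
qed

lemma gdist_eqI:
  assumes "walk E xs" "hd xs = u" "last xs = v" "length xs = Suc m"
    and "\<And>ys. walk E ys \<Longrightarrow> hd ys = u \<Longrightarrow> last ys = v \<Longrightarrow> m \<le> length ys - 1"
  shows "gdist E u v = enat m"
proof (rule antisym)
  show "gdist E u v \<le> enat m" unfolding gdist_def using assms by (intro INF_lower) blast
  show "enat m \<le> gdist E u v" unfolding gdist_def using assms(5) by (intro INF_greatest) force
qed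

text \<open>An infimum over no lengths is infinite, so some walk exists, and a nonempty set of
  extended naturals contains its infimum.\<close>

lemma gdist_attained:
  assumes "gdist E u v = enat m"
  shows "\<exists>xs. walk E xs \<and> hd xs = u \<and> last xs = v \<and> length xs = Suc m"
proof -
  define N where "N = enat ` {n. \<exists>xs. walk E xs \<and> hd xs = u \<and> last xs = v \<and> length xs = Suc n}"
  have Inf: "Inf N = enat m" using assms by (simp add: gdist_def N_def)
  have "N \<noteq> {}"
  proof
    assume "N = {}"
    then show False using Inf by (simp add: Inf_enat_def)
  qed
  then obtain x where "x \<in> N" by blast
  then have "Inf N \<in> N" unfolding Inf_enat_def by (metis LeastI emptyE)
  then show ?thesis unfolding Inf by (auto simp: N_def)
qed

lemma walk_Cons: "walk E (u # xs) \<longleftrightarrow> xs = [] \<or> E u (hd xs) \<and> walk E xs"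
proof (cases xs)
  case (Cons v ys)
  show ?thesis unfolding walk_def Cons by (auto simp: nth_Cons split: nat.splits)
qed (simp add: walk_def)

lemma walk_appendD:
  assumes "walk E (xs @ u # ys)"
  shows "walk E (xs @ [u])" "walk E (u # ys)"
proof -
  have "walk E (xs @ [u]) \<and> walk E (u # ys)" using assms
  proof (induction xs)
    case (Cons x xs)
    then show ?case by (cases xs) (auto simp: walk_Cons)
  qed (simp add: walk_def)
  then show "walk E (xs @ [u])" "walk E (u # ys)" by auto
qed

text \<open>Here labels encode adjacency only, which already bounds distances from below. The
  converse direction, on Doubled Odd graphs, works with this weaker form.\<close>

locale cube_labelling =
  fixes V :: "'a set" and E :: "'a \<Rightarrow> 'a \<Rightarrow> bool" and f :: "'a \<Rightarrow> 'e set"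
  assumes inj: "inj_on f V"
    and finite_label: "u \<in> V \<Longrightarrow> finite (f u)"
    and edge_iff: "E u v \<longleftrightarrow> u \<in> V \<and> v \<in> V \<and> card (f u \<oplus> f v) = 1"
begin

lemma walk_subset:
  assumes "walk E xs" "hd xs \<in> V"
  shows "set xs \<subseteq> V"
  using assms
proof (induction xs)
  case (Cons u xs)
  then show ?case by (cases "xs = []") (auto simp: walk_Cons edge_iff)
qed simp

lemma card_xor_le_walk_length:
  assumes "walk E xs" "hd xs \<in> V"
  shows "card (f (hd xs) \<oplus> f (last xs)) \<le> length xs - 1"
  using assms
proof (induction xs)
  case (Cons u xs)
  show ?case
  proof (cases "xs = []")
    case False
    then have xs: "E u (hd xs)" "walk E xs" using Cons.prems by (auto simp: walk_Cons)
    then have hd: "hd xs \<in> V" "u \<in> V" "card (f u \<oplus> f (hd xs)) = 1" by (auto simp: edge_iff)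
    have "last xs \<in> V" using walk_subset[OF xs(2) hd(1)] False by auto
    then have "card (f u \<oplus> f (last xs)) \<le> 1 + card (f (hd xs) \<oplus> f (last xs))"
      using card_xor_triangle[of "f u" "f (hd xs)" "f (last xs)"] hd finite_label by simp
    also have "\<dots> \<le> 1 + (length xs - 1)" using Cons.IH[OF xs(2) hd(1)] by simp
    finally show ?thesis using False by (cases xs) auto
  qed simp
qed (simp add: walk_def)

end

text \<open>This is isometry in one-step form: some edge at \<open>u\<close> leads closer to
  \<open>v\<close>. Iteration gives geodesics, and for the set of labels it is the assumption
  \<open>isometric\<close> of \<open>hexagonal_family\<close>.\<close>

locale isometric_labelling = cube_labelling +
  assumes isometric_step: "u \<in> V \<Longrightarrow> v \<in> V \<Longrightarrow> u \<noteq> v \<Longrightarrow> \<exists>e\<in>f u \<oplus> f v. f u \<oplus> {e} \<in> f ` V"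
begin

lemma geodesic_exists:
  assumes "u \<in> V" "v \<in> V"
  shows "\<exists>xs. walk E xs \<and> hd xs = u \<and> last xs = v \<and> length xs = Suc (card (f u \<oplus> f v))"
  using assms
proof (induction "card (f u \<oplus> f v)" arbitrary: u)
  case 0
  then have "f u = f v" using finite_label by simp
  then have "u = v" using inj 0 by (auto dest: inj_onD)
  then show ?case by (intro exI[of _ "[u]"]) (simp add: walk_def)
next
  case (Suc n)
  then have "u \<noteq> v" by auto
  then obtain e w where e: "e \<in> f u \<oplus> f v" and w: "w \<in> V" "f w = f u \<oplus> {e}"
    using isometric_step Suc.prems by blast
  have "f w \<oplus> f v = (f u \<oplus> f v) - {e}" unfolding w(2) using e by (auto simp: set_eq_iff)
  then have n: "n = card (f w \<oplus> f v)" using e Suc.hyps(2) by simp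
  then obtain xs where xs: "walk E xs" "hd xs = w" "last xs = v" "length xs = Suc n"
    using Suc.hyps(1)[OF n w(1) Suc.prems(2)] by auto
  have "E u w" using w Suc.prems(1) by (simp add: edge_iff card_xor_eq_1_iff)
  then have "walk E (u # xs)" using xs by (simp add: walk_Cons)
  moreover have "xs \<noteq> []" using xs(4) by auto
  ultimately show ?case using xs Suc.hyps(2) by (intro exI[of _ "u # xs"]) auto
qed

lemma gdist_eq_card_xor:
  assumes "u \<in> V" "v \<in> V"
  shows "gdist E u v = enat (card (f u \<oplus> f v))"
proof -
  obtain xs where "walk E xs" "hd xs = u" "last xs = v" "length xs = Suc (card (f u \<oplus> f v))"
    using geodesic_exists assms by blast
  then show ?thesis
  proof (rule gdist_eqI)
    fix ys assume "walk E ys" "hd ys = u" "last ys = v"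
    then show "card (f u \<oplus> f v) \<le> length ys - 1"
      using card_xor_le_walk_length[of ys] assms(1) by simp
  qed
qed

text \<open>When the geodesic is cut at \<open>w\<close>, each piece is at least as long as the
  distance of its end labels, so \<open>f w\<close> attains equality in the triangle
  inequality.\<close>

lemma geodesic_between:
  assumes "walk E xs" "hd xs \<in> V" "length xs - 1 = card (f (hd xs) \<oplus> f (last xs))" "w \<in> set xs"
  shows "f (hd xs) \<oplus> f w \<subseteq> f (hd xs) \<oplus> f (last xs)"
proof -
  obtain ys zs where xs: "xs = ys @ w # zs" using assms(4) by (meson split_list)
  have walks: "walk E (ys @ [w])" "walk E (w # zs)"
    using walk_appendD[of E ys w zs] assms(1) xs by simp_all
  have "xs \<noteq> []" using assms(4) by auto
  then have V: "w \<in> V" "last xs \<in> V" using walk_subset[OF assms(1,2)] assms(4) last_in_set by blast+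
  have hd: "hd (ys @ [w]) = hd xs" and last: "last (w # zs) = last xs"
    by (cases ys) (simp_all add: xs)
  have "card (f (hd xs) \<oplus> f w) \<le> length ys"
    using card_xor_le_walk_length[OF walks(1)] assms(2) unfolding hd by simp
  moreover have "card (f w \<oplus> f (last xs)) \<le> length zs"
    using card_xor_le_walk_length[OF walks(2)] V(1) unfolding last by simp
  ultimately have "card (f (hd xs) \<oplus> f w) + card (f w \<oplus> f (last xs)) \<le> card (f (hd xs) \<oplus> f (last xs))"
    unfolding assms(3)[symmetric] by (simp add: xs)
  then show ?thesis using xor_subset_if_between finite_label assms(2) V by blast
qed

end

section \<open>Hypercubes and partial cubes\<close>

definition cube_label :: "nat \<Rightarrow> bool list \<Rightarrow> nat set" where
  "cube_label n xs = {i. i < n \<and> xs ! i}"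

lemma isometric_labelling_cube: "isometric_labelling (cube_V n) (cube_E n) (cube_label n)"
proof
  show inj: "inj_on (cube_label n) (cube_V n)"
  proof (rule inj_onI)
    fix u v assume "u \<in> cube_V n" "v \<in> cube_V n" and eq: "cube_label n u = cube_label n v"
    then have len: "length u = n" "length v = n" by (auto simp: cube_V_def)
    have "u ! i \<longleftrightarrow> v ! i" if "i < n" for i
      using that eq unfolding cube_label_def by blast
    then show "u = v" using len by (intro nth_equalityI) auto
  qed
  show "finite (cube_label n u)" for u by (simp add: cube_label_def)
  have eq: "cube_label n u \<oplus> cube_label n v = {i. i < n \<and> u ! i \<noteq> v ! i}" for u v
    by (auto simp: cube_label_def)
  show "cube_E n u v \<longleftrightarrow> u \<in> cube_V n \<and> v \<in> cube_V n \<and> card (cube_label n u \<oplus> cube_label n v) = 1" for u v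
    by (simp add: cube_E_def eq)
  have all: "A \<in> cube_label n ` cube_V n" if "A \<subseteq> {..<n}" for A
  proof
    show "A = cube_label n (map (\<lambda>i. i \<in> A) [0..<n])" using that by (auto simp: cube_label_def)
  qed (simp add: cube_V_def)
  fix u v assume uv: "u \<in> cube_V n" "v \<in> cube_V n" "u \<noteq> v"
  then have "cube_label n u \<noteq> cube_label n v" using inj by (auto dest: inj_onD)
  then obtain e where e: "e \<in> cube_label n u \<oplus> cube_label n v" by (metis equals0I xor_eq_empty_iff)
  then have "cube_label n u \<oplus> {e} \<subseteq> {..<n}" by (auto simp: cube_label_def)
  then show "\<exists>e\<in>cube_label n u \<oplus> cube_label n v. cube_label n u \<oplus> {e} \<in> cube_label n ` cube_V n"
    using e all by blast
qed

lemma partial_cube_imp_isometric_labelling: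
  assumes "graph V E" "partial_cube V E"
  shows "\<exists>f :: 'a \<Rightarrow> nat set. isometric_labelling V E f"
proof -
  obtain n VH EH g where H: "isometric_subgraph VH EH (cube_V n) (cube_E n)"
    and g: "bij_betw g V VH" "\<And>u v. u \<in> V \<Longrightarrow> v \<in> V \<Longrightarrow> E u v \<longleftrightarrow> EH (g u) (g v)"
    using assms(2) by (auto simp: partial_cube_def graph_iso_def)
  interpret Q: isometric_labelling "cube_V n" "cube_E n" "cube_label n"
    by (rule isometric_labelling_cube)
  let ?L = "cube_label n"
  have sub: "VH \<subseteq> cube_V n" "\<And>u v. EH u v \<Longrightarrow> cube_E n u v" "\<And>u v. EH u v \<Longrightarrow> u \<in> VH \<and> v \<in> VH"
    using H by (auto simp: isometric_subgraph_def subgraph_def graph_def)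
  \<comment> \<open>\<open>w\<close> is the second vertex of a shortest path in the subgraph. The
    rest of the path is so short that the flipped coordinate must separate \<open>u\<close> from
    \<open>v\<close>.\<close>
  have step: "\<exists>w e. w \<in> VH \<and> EH u w \<and> ?L w = ?L u \<oplus> {e} \<and> e \<in> ?L u \<oplus> ?L v"
    if uv: "u \<in> VH" "v \<in> VH" "u \<noteq> v" for u v
  proof -
    have uvQ: "u \<in> cube_V n" "v \<in> cube_V n" using uv sub by auto
    then have dist: "gdist EH u v = enat (card (?L u \<oplus> ?L v))"
      using H uv Q.gdist_eq_card_xor by (simp add: isometric_subgraph_def)
    obtain xs where xs: "walk EH xs" "hd xs = u" "last xs = v"
      "length xs = Suc (card (?L u \<oplus> ?L v))"
      using gdist_attained[OF dist] by blast
    then obtain ys where ys: "xs = u # ys" by (cases xs) (auto simp: walk_def)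
    have "ys \<noteq> []" using ys xs(3) uv(3) by auto
    then have w: "EH u (hd ys)" "walk EH ys" "last ys = v" using xs ys by (auto simp: walk_Cons)
    then have "walk (cube_E n) ys" using sub by (auto simp: walk_def)
    moreover have wQ: "hd ys \<in> cube_V n" "hd ys \<in> VH" using w(1) sub by blast+
    ultimately have le: "card (?L (hd ys) \<oplus> ?L v) \<le> length ys - 1"
      using Q.card_xor_le_walk_length[of ys] w(3) by simp
    have "card (?L u \<oplus> ?L (hd ys)) = 1" using sub(2)[OF w(1)] by (simp add: Q.edge_iff)
    then obtain e where e: "?L (hd ys) = ?L u \<oplus> {e}" unfolding card_xor_eq_1_iff by blast
    have "?L u \<oplus> ?L (hd ys) \<subseteq> ?L u \<oplus> ?L v"
      using xor_subset_if_between[of "?L u" "?L (hd ys)" "?L v"] Q.finite_label uvQ wQ le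
        \<open>card (?L u \<oplus> ?L (hd ys)) = 1\<close> xs(4) ys \<open>ys \<noteq> []\<close> by (cases ys) auto
    then have "e \<in> ?L u \<oplus> ?L v" unfolding e by simp
    then show ?thesis using e w(1) wQ by blast
  qed
  \<comment> \<open>The definition of a subgraph does not make it induced, but isometry does: for
    labels at distance one, the step from \<open>u\<close> towards \<open>v\<close> must arrive at
    \<open>v\<close>.\<close>
  have EH_iff: "EH u v \<longleftrightarrow> card (?L u \<oplus> ?L v) = 1" if uv: "u \<in> VH" "v \<in> VH" for u v
  proof
    assume "EH u v"
    then show "card (?L u \<oplus> ?L v) = 1" using sub by (simp add: Q.edge_iff)
  next
    assume 1: "card (?L u \<oplus> ?L v) = 1"
    then have "u \<noteq> v" by auto
    then obtain w e where w: "w \<in> VH" "EH u w" "?L w = ?L u \<oplus> {e}" "e \<in> ?L u \<oplus> ?L v"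
      using step uv by blast
    have "?L u \<oplus> ?L v = {e}" using 1 w(4) by (metis card_1_singletonE singletonD)
    then have "?L w = ?L v" using w(3) by (metis xor_cancel)
    then have "w = v" using inj_onD[OF Q.inj, of w v] w(1) uv sub(1) by blast
    then show "EH u v" using w by simp
  qed
  have gV: "g u \<in> VH" if "u \<in> V" for u using g(1) that by (auto simp: bij_betw_def)
  have "isometric_labelling V E (\<lambda>u. ?L (g u))"
  proof
    show "inj_on (\<lambda>u. ?L (g u)) V"
      using g(1) comp_inj_on[of g V ?L] inj_on_subset[OF Q.inj sub(1)] by (auto simp: bij_betw_def comp_def)
    show "finite (?L (g u))" for u by (simp add: cube_label_def)
    show "E u v \<longleftrightarrow> u \<in> V \<and> v \<in> V \<and> card (?L (g u) \<oplus> ?L (g v)) = 1" for u v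
      using assms(1) g(2) EH_iff gV unfolding graph_def by metis
    fix u v assume uv: "u \<in> V" "v \<in> V" "u \<noteq> v"
    then have "g u \<noteq> g v" using g(1) by (auto simp: bij_betw_def dest: inj_onD)
    then obtain w e where w: "w \<in> VH" "?L w = ?L (g u) \<oplus> {e}" "e \<in> ?L (g u) \<oplus> ?L (g v)"
      using step gV uv by blast
    obtain w' where "w' \<in> V" "g w' = w" using g(1) w(1) by (auto simp: bij_betw_def)
    then show "\<exists>e\<in>?L (g u) \<oplus> ?L (g v). ?L (g u) \<oplus> {e} \<in> (\<lambda>u. ?L (g u)) ` V"
      using w by (intro bexI[of _ e]) auto
  qed
  then show ?thesis by blast
qed

section \<open>Distances along antipodal cycles\<close>

lemma card_take_xor_take:
  assumes "distinct es" "i \<le> j" "j \<le> length es"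
  shows "card (set (take i es) \<oplus> set (take j es)) = j - i"
proof -
  have sub: "set (take i es) \<subseteq> set (take j es)" using assms(2) by (rule set_take_subset_set_take)
  have "card (set (take i es)) = i" "card (set (take j es)) = j"
    using assms by (simp_all add: distinct_card)
  then show ?thesis
    unfolding xor_subset(1)[OF sub] using card_Diff_subset[OF _ sub] by simp
qed

lemma set_drop_eq_xor:
  assumes "distinct es"
  shows "set (drop k es) = set es \<oplus> set (take k es)"
proof -
  have "set es = set (take k es) \<union> set (drop k es)" by (metis append_take_drop_id set_append)
  moreover have "set (take k es) \<inter> set (drop k es) = {}"
    using set_take_disj_set_drop_if_distinct[OF assms, of k k] by simp
  ultimately show ?thesis by auto
qed

text \<open>The right-hand side is the distance on a cycle with \<open>2 * length es\<close>
  vertices. In the second half, \<open>cyc es i\<close> is the complement in \<open>set es\<close>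
  of a prefix, so everything reduces to distances of prefixes, complemented when \<open>i\<close>
  and \<open>j\<close> lie in different halves.\<close>

lemma card_cyc_xor_cyc:
  assumes es: "distinct es" and "i \<le> j" "j < 2 * length es"
  shows "card (cyc es i \<oplus> cyc es j) = min (j - i) (2 * length es - (j - i))"
proof -
  let ?T = "\<lambda>i. set (take i es)" and ?m = "length es"
  have eq: "cyc es i = (if i \<le> ?m then ?T i else set es \<oplus> ?T (i - ?m))" for i
    by (simp add: cyc_def set_drop_eq_xor[OF es])
  consider "j \<le> ?m" | "i \<le> ?m" "?m < j" | "?m < i" using assms(2) by linarith
  then show ?thesis
  proof cases
    case 1
    then show ?thesis using assms card_take_xor_take[OF es, of i j] by (simp add: eq)
  next
    case 2
    define k where "k = j - ?m"
    have k: "k \<le> ?m" "j = ?m + k" using assms 2 by (auto simp: k_def)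
    have sub: "?T i \<oplus> ?T k \<subseteq> set es" using set_take_subset[of i es] set_take_subset[of k es] by auto
    have "cyc es i \<oplus> cyc es j = set es \<oplus> (?T i \<oplus> ?T k)"
      using 2 k by (simp add: eq) (metis xor_assoc xor_commute)
    then have "card (cyc es i \<oplus> cyc es j) = ?m - card (?T i \<oplus> ?T k)"
      unfolding xor_subset(2)[OF sub] using card_Diff_subset[OF _ sub] distinct_card[OF es] by simp
    moreover have "card (?T i \<oplus> ?T k) = (if i \<le> k then k - i else i - k)"
      using card_take_xor_take[OF es, of i k] card_take_xor_take[OF es, of k i] 2(1) k(1)
      unfolding xor_commute[of "?T k" "?T i"] by (cases "i \<le> k") simp_all
    ultimately show ?thesis using 2 k by (auto simp: min_def)
  next
    case 3
    then have "cyc es i \<oplus> cyc es j = ?T (i - ?m) \<oplus> ?T (j - ?m)" using assms by (simp add: eq)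
    then show ?thesis using card_take_xor_take[OF es, of "i - ?m" "j - ?m"] assms 3 by simp
  qed
qed

lemma inj_on_cyc:
  assumes "distinct es"
  shows "inj_on (cyc es) {..<2 * length es}"
proof (rule linorder_inj_onI)
  fix i j assume ij: "i < j" "i \<in> {..<2 * length es}" "j \<in> {..<2 * length es}"
  then have "card (cyc es i \<oplus> cyc es j) \<noteq> 0" using card_cyc_xor_cyc[OF assms, of i j] by auto
  then show "cyc es i \<noteq> cyc es j" by auto
qed auto

lemma card_cyc_xor_cyc_eq_1_iff:
  assumes "distinct es" "2 \<le> length es" "i < 2 * length es" "j < 2 * length es"
  shows "card (cyc es i \<oplus> cyc es j) = 1 \<longleftrightarrow>
    j = (i + 1) mod (2 * length es) \<or> i = (j + 1) mod (2 * length es)"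
proof -
  have mod: "(n + 1) mod (2 * length es) = (if n + 1 = 2 * length es then 0 else n + 1)"
    if "n < 2 * length es" for n
    using that by simp
  have *: "card (cyc es i \<oplus> cyc es j) = 1 \<longleftrightarrow>
    j = (i + 1) mod (2 * length es) \<or> i = (j + 1) mod (2 * length es)"
    if "i \<le> j" "j < 2 * length es" for i j
    unfolding card_cyc_xor_cyc[OF assms(1) that] mod[OF that(2)] mod[OF le_less_trans[OF that]]
    using that assms(2) by (auto simp: min_def)
  show ?thesis
    using *[of i j] *[of j i] assms(3,4) by (cases "i \<le> j") (auto simp: xor_commute)
qed

section \<open>Convex cycles cut out by subcubes\<close>

context isometric_labelling
begin

text \<open>\<open>VH\<close> consists of the vertices in the subcube through \<open>D\<close>
  spanned by \<open>set es\<close>. Geodesics never leave a subcube, which gives convexity, and the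
  distances along \<open>cyc es\<close> identify the edges as those of a cycle.\<close>

lemma convex_cycle_of_cyc:
  assumes finV: "finite V" and D: "D \<in> f ` V" and es: "distinct es" "2 \<le> length es"
    and hull: "{R. R \<subseteq> set es \<and> D \<oplus> R \<in> f ` V} = cyc es ` {..<2 * length es}"
  shows "\<exists>VH EH. convex_cycle VH EH (2 * length es) V E"
proof -
  let ?l = "2 * length es"
  define VH where "VH = {u \<in> V. D \<oplus> f u \<subseteq> set es}"
  define EH where "EH u v \<longleftrightarrow> E u v \<and> u \<in> VH \<and> v \<in> VH" for u v
  define c where "c i = the_inv_into V f (D \<oplus> cyc es i)" for i
  have in_hull: "cyc es i \<subseteq> set es" "D \<oplus> cyc es i \<in> f ` V" if "i < ?l" for i
    using hull that by blast+
  have "f (c i) = D \<oplus> cyc es i" if "i < ?l" for i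
    unfolding c_def by (rule f_the_inv_into_f[OF inj in_hull(2)[OF that]])
  moreover have "c i \<in> V" if "i < ?l" for i
    unfolding c_def by (rule the_inv_into_into[OF inj in_hull(2)[OF that] subset_refl])
  ultimately have fc: "f (c i) = D \<oplus> cyc es i" "c i \<in> V" if "i < ?l" for i
    using that by blast+
  have VH_eq: "VH = c ` {..<?l}"
  proof (intro equalityI subsetI)
    fix u assume u: "u \<in> VH"
    then have "D \<oplus> f u \<in> {R. R \<subseteq> set es \<and> D \<oplus> R \<in> f ` V}" by (simp add: VH_def)
    then obtain i where i: "i < ?l" "D \<oplus> f u = cyc es i" unfolding hull by blast
    then have "f u = f (c i)" using fc(1)[OF i(1)] by (metis xor_cancel)
    then have "u = c i" using inj u fc(2)[OF i(1)] by (auto simp: VH_def dest: inj_onD)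
    then show "u \<in> c ` {..<?l}" using i(1) by blast
  next
    fix u assume "u \<in> c ` {..<?l}"
    then obtain i where i: "i < ?l" "u = c i" by blast
    then show "u \<in> VH" using fc[OF i(1)] in_hull(1)[OF i(1)] by (simp add: VH_def)
  qed
  have dist: "f (c i) \<oplus> f (c j) = cyc es i \<oplus> cyc es j" if "i < ?l" "j < ?l" for i j
    using fc that by simp
  have c_in: "c i \<in> VH" if "i < ?l" for i using that VH_eq by blast
  have edge: "EH (c i) (c j) \<longleftrightarrow> j = (i + 1) mod ?l \<or> i = (j + 1) mod ?l" if "i < ?l" "j < ?l" for i j
    unfolding EH_def edge_iff using that c_in fc(2) dist card_cyc_xor_cyc_eq_1_iff[OF es that] by simp
  have inj_c: "inj_on c {..<?l}"
  proof (rule inj_onI)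
    fix i j assume ij: "i \<in> {..<?l}" "j \<in> {..<?l}" "c i = c j"
    then have "cyc es i = cyc es j" using fc(1)[of i] fc(1)[of j] by simp
    then show "i = j" using inj_onD[OF inj_on_cyc[OF es(1)]] ij by blast
  qed
  have "is_cycle VH EH ?l"
    unfolding is_cycle_def
  proof (intro conjI exI[of _ "map c [0..<?l]"] allI)
    show "distinct (map c [0..<?l])" using inj_c by (simp add: distinct_map atLeast0LessThan)
    show "set (map c [0..<?l]) = VH" by (simp add: VH_eq atLeast0LessThan)
    fix u v
    have nth: "map c [0..<?l] ! i = c i" if "i < ?l" for i using that by simp
    have mod: "(i + 1) mod ?l < ?l" for i
      by (rule mod_less_divisor) (use es(2) in linarith)
    show "EH u v \<longleftrightarrow> (\<exists>i<?l. (u = map c [0..<?l] ! i \<and> v = map c [0..<?l] ! ((i + 1) mod ?l))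
      \<or> (v = map c [0..<?l] ! i \<and> u = map c [0..<?l] ! ((i + 1) mod ?l)))"
    proof
      assume uv: "EH u v"
      then obtain i j where "i < ?l" "u = c i" "j < ?l" "v = c j" using VH_eq by (auto simp: EH_def)
      then show "\<exists>i<?l. (u = map c [0..<?l] ! i \<and> v = map c [0..<?l] ! ((i + 1) mod ?l))
        \<or> (v = map c [0..<?l] ! i \<and> u = map c [0..<?l] ! ((i + 1) mod ?l))"
        using uv edge[of i j] nth mod by metis
    next
      assume "\<exists>i<?l. (u = map c [0..<?l] ! i \<and> v = map c [0..<?l] ! ((i + 1) mod ?l))
        \<or> (v = map c [0..<?l] ! i \<and> u = map c [0..<?l] ! ((i + 1) mod ?l))"
      then obtain i where i: "i < ?l" "(u = c i \<and> v = c ((i + 1) mod ?l)) \<or> (v = c i \<and> u = c ((i + 1) mod ?l))"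
        using nth mod by metis
      then show "EH u v" using edge[of i "(i + 1) mod ?l"] edge[of "(i + 1) mod ?l" i] mod by metis
    qed
  qed (use es(2) in auto)
  moreover have "convex_subgraph VH EH V E"
  proof -
    have sub: "VH \<subseteq> V" by (auto simp: VH_def)
    \<comment> \<open>The one-step property survives restriction to \<open>VH\<close>, so distances
      in the subgraph and in the whole graph are given by the same labels.\<close>
    interpret H: isometric_labelling VH EH f
    proof
      show "inj_on f VH" using inj sub by (rule inj_on_subset)
      show "finite (f u)" if "u \<in> VH" for u using that sub finite_label by blast
      show "EH u v \<longleftrightarrow> u \<in> VH \<and> v \<in> VH \<and> card (f u \<oplus> f v) = 1" for u v
        using sub by (auto simp: EH_def edge_iff)
      fix u v assume uv: "u \<in> VH" "v \<in> VH" "u \<noteq> v"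
      then obtain e w where e: "e \<in> f u \<oplus> f v" and w: "w \<in> V" "f w = f u \<oplus> {e}"
        using isometric_step[of u v] sub by blast
      have "D \<oplus> f w \<subseteq> set es"
      proof
        fix x assume "x \<in> D \<oplus> f w"
        then have "x \<in> D \<oplus> f u \<or> x \<in> D \<oplus> f v" using e unfolding w(2) by auto
        then show "x \<in> set es" using uv by (auto simp: VH_def simp del: in_xor_iff)
      qed
      then have "w \<in> VH" using w(1) by (simp add: VH_def)
      then show "\<exists>e\<in>f u \<oplus> f v. f u \<oplus> {e} \<in> f ` VH" using e w(2) by (metis image_eqI)
    qed
    have "EH u v \<Longrightarrow> EH v u" "\<not> EH u u" for u v by (auto simp: H.edge_iff xor_commute)
    then have "graph VH EH" using sub finV finite_subset unfolding graph_def EH_def by blast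
    moreover have "gdist EH u v = gdist E u v" if "u \<in> VH" "v \<in> VH" for u v
      using that sub H.gdist_eq_card_xor gdist_eq_card_xor by (simp add: subset_iff)
    moreover have "set xs \<subseteq> VH \<and> walk EH xs"
      if uv: "u \<in> VH" "v \<in> VH" and xs: "walk E xs" "hd xs = u" "last xs = v"
        "enat (length xs - 1) = gdist E u v" for u v xs
    proof -
      have len: "length xs - 1 = card (f (hd xs) \<oplus> f (last xs))"
        using xs(2-4) gdist_eq_card_xor[OF subsetD[OF sub uv(1)] subsetD[OF sub uv(2)]] by simp
      have hdV: "hd xs \<in> V" using xs uv sub by blast
      have "w \<in> VH" if "w \<in> set xs" for w
      proof -
        have "f u \<oplus> f w \<subseteq> f u \<oplus> f v" using geodesic_between[OF xs(1) hdV len that] xs by simp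
        have "D \<oplus> f w \<subseteq> set es"
        proof
          fix x assume "x \<in> D \<oplus> f w"
          then have "x \<in> D \<oplus> f u \<or> x \<in> D \<oplus> f v" using \<open>f u \<oplus> f w \<subseteq> f u \<oplus> f v\<close> by auto
          then show "x \<in> set es" using uv by (auto simp: VH_def simp del: in_xor_iff)
        qed
        then show ?thesis using walk_subset[OF xs(1) hdV] that by (auto simp: VH_def)
      qed
      then show ?thesis using xs(1) by (auto simp: walk_def EH_def)
    qed
    ultimately show ?thesis
      using sub unfolding convex_subgraph_def isometric_subgraph_def subgraph_def EH_def by blast
  qed
  ultimately show ?thesis unfolding convex_cycle_def by blast
qed

lemma hexagonal_family_labels:
  assumes "finite V" "\<And>VH EH l. convex_cycle VH EH l V E \<Longrightarrow> l = 6"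
  shows "hexagonal_family (f ` V)"
proof
  show "finite A" if "A \<in> f ` V" for A using that finite_label by blast
  show "\<exists>e\<in>A \<oplus> B. A \<oplus> {e} \<in> f ` V" if "A \<in> f ` V" "B \<in> f ` V" "A \<noteq> B" for A B
    using that isometric_step by blast
  show "length es = 3" if "D \<in> f ` V" "distinct es" "2 \<le> length es"
    "{R. R \<subseteq> set es \<and> D \<oplus> R \<in> f ` V} = cyc es ` {..<2 * length es}" for D es
    using convex_cycle_of_cyc[OF assms(1) that] assms(2) by fastforce
qed

end

context cube_labelling
begin

lemma card_dirs_eq_degree:
  assumes "v \<in> V"
  shows "card (dirs (f ` V) (f v)) = card {u \<in> V. E v u}"
proof -
  have "(\<lambda>e. f v \<oplus> {e}) ` dirs (f ` V) (f v) = f ` {u \<in> V. E v u}" (is "?l = ?r")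
  proof (intro equalityI subsetI)
    fix A assume "A \<in> ?l"
    then obtain e u where "A = f v \<oplus> {e}" "u \<in> V" "f u = f v \<oplus> {e}" by (auto simp: dirs_def)
    then have "A = f u" "E v u" using assms by (auto simp: edge_iff)
    then show "A \<in> ?r" using \<open>u \<in> V\<close> by blast
  next
    fix A assume "A \<in> ?r"
    then obtain u where u: "A = f u" "u \<in> V" "E v u" by blast
    then obtain e where "f u = f v \<oplus> {e}" using edge_iff card_xor_eq_1_iff by metis
    then show "A \<in> ?l" using u by (auto simp: dirs_def)
  qed
  moreover have "inj_on (\<lambda>e. f v \<oplus> {e}) (dirs (f ` V) (f v))" by (auto intro: inj_onI)
  moreover have "inj_on f {u \<in> V. E v u}" using inj by (rule inj_on_subset) auto
  ultimately show ?thesis using card_image[of "\<lambda>e. f v \<oplus> {e}"] card_image[of f] by metis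
qed

end

section \<open>Doubled Odd graphs\<close>

lemma image_xor:
  assumes "inj_on h C" "A \<subseteq> C" "B \<subseteq> C"
  shows "h ` (A \<oplus> B) = h ` A \<oplus> h ` B"
proof -
  have "A - B \<subseteq> C" "B - A \<subseteq> C" using assms by auto
  then show ?thesis
    unfolding xor_def image_Un using assms by (simp add: inj_on_image_set_diff[OF assms(1)])
qed

lemma finite_DO_V: "A \<in> DO_V k \<Longrightarrow> finite A"
  using finite_subset[of A "{1..2 * k - 1}"] by (simp add: DO_V_def)

text \<open>Sets differing in one element are nested with sizes differing by one, which within the
  two layers must be \<open>k - 1\<close> and \<open>k\<close>.\<close>

lemma DO_E_iff_card_xor:
  assumes "1 \<le> k" "A \<in> DO_V k" "B \<in> DO_V k"
  shows "DO_E k A B \<longleftrightarrow> card (A \<oplus> B) = 1"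
proof
  have *: "card (A \<oplus> B) = 1" if "A \<subset> B" "card A = k - 1" "card B = k" "finite A" for A B :: "nat set"
    using that assms(1) card_Diff_subset[of A B] by (simp add: xor_subset)
  assume "DO_E k A B"
  then show "card (A \<oplus> B) = 1"
    using *[of A B] *[of B A] finite_DO_V[OF assms(2)] finite_DO_V[OF assms(3)]
    unfolding DO_E_def xor_commute[of B A] by blast
next
  assume "card (A \<oplus> B) = 1"
  then obtain e where e: "B = A \<oplus> {e}" unfolding card_xor_eq_1_iff by blast
  have fin: "finite A" using finite_DO_V assms by blast
  have cards: "card A = k - 1 \<or> card A = k" "card B = k - 1 \<or> card B = k"
    using assms by (auto simp: DO_V_def)
  show "DO_E k A B"
  proof (cases "e \<in> A")
    case True
    then have "B = A - {e}" unfolding e by (simp add: xor_subset)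
    moreover have "card A > 0" using True fin card_gt_0_iff by blast
    ultimately show ?thesis using assms cards True fin by (auto simp: DO_E_def)
  next
    case False
    then have "B = insert e A" unfolding e by (simp add: xor_disjoint)
    then show ?thesis using assms cards False fin by (auto simp: DO_E_def)
  qed
qed

context cube_labelling
begin

text \<open>Translation by \<open>S\<close> and renaming of \<open>v\<close> by a bijection
  \<open>h\<close> both preserve the sizes of symmetric differences, and these determine
  adjacency.\<close>

lemma graph_iso_DO_if_middle_layers:
  assumes "finite v" "card v = 2 * d - 1" "1 \<le> d"
    and layers: "(\<oplus>) S ` f ` V = {Z. Z \<subseteq> v \<and> (card Z = d - 1 \<or> card Z = d)}" (is "_ = ?M")
  shows "graph_iso V E (DO_V d) (DO_E d)"
proof -
  obtain h where h: "bij_betw h v {1..2 * d - 1}"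
    using finite_same_card_bij[of v "{1..2 * d - 1}"] assms by auto
  have inj_h: "inj_on h v" and im_h: "h ` v = {1..2 * d - 1}" using h by (auto simp: bij_betw_def)
  have "inj_on (\<lambda>u. S \<oplus> f u) V" using inj by (simp add: inj_on_def)
  then have 1: "bij_betw (\<lambda>u. S \<oplus> f u) V ?M" using layers by (simp add: bij_betw_def image_image)
  have card_h: "card (h ` Z) = card Z" if "Z \<subseteq> v" for Z
    using inj_on_subset[OF inj_h that] by (rule card_image)
  have "inj_on ((`) h) ?M" using inj_on_image_Pow[OF inj_h] by (rule inj_on_subset) auto
  moreover have "(`) h ` ?M = DO_V d"
  proof (intro equalityI subsetI)
    fix A assume "A \<in> (`) h ` ?M"
    then obtain Z where Z: "A = h ` Z" "Z \<subseteq> v" "card Z = d - 1 \<or> card Z = d" by blast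
    then show "A \<in> DO_V d" using card_h[OF Z(2)] im_h image_mono[OF Z(2), of h] by (simp add: DO_V_def)
  next
    fix A assume A: "A \<in> DO_V d"
    then have "A \<subseteq> h ` v" using im_h by (simp add: DO_V_def)
    then obtain Z where Z: "Z \<subseteq> v" "A = h ` Z" by (meson subset_imageE)
    then show "A \<in> (`) h ` ?M" using A card_h[OF Z(1)] by (auto simp: DO_V_def)
  qed
  ultimately have 2: "bij_betw ((`) h) ?M (DO_V d)" by (simp add: bij_betw_def)
  define g where "g u = h ` (S \<oplus> f u)" for u
  have g: "bij_betw g V (DO_V d)"
    using bij_betw_trans[OF 1 2] by (simp add: g_def[abs_def] comp_def)
  have "E u w \<longleftrightarrow> DO_E d (g u) (g w)" if uw: "u \<in> V" "w \<in> V" for u w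
  proof -
    have sub: "S \<oplus> f u \<subseteq> v" "S \<oplus> f w \<subseteq> v" using 1 uw unfolding bij_betw_def by blast+
    have "g u \<oplus> g w = h ` ((S \<oplus> f u) \<oplus> (S \<oplus> f w))"
      unfolding g_def by (rule image_xor[OF inj_h sub, symmetric])
    also have "(S \<oplus> f u) \<oplus> (S \<oplus> f w) = f u \<oplus> f w" by simp
    finally have eq: "g u \<oplus> g w = h ` (f u \<oplus> f w)" .
    have "f u \<oplus> f w \<subseteq> v"
    proof
      fix x assume "x \<in> f u \<oplus> f w"
      then have "x \<in> S \<oplus> f u \<or> x \<in> S \<oplus> f w" by auto
      then show "x \<in> v" using sub by blast
    qed
    then have "card (g u \<oplus> g w) = card (f u \<oplus> f w)" unfolding eq by (rule card_h)
    moreover have "g u \<in> DO_V d" "g w \<in> DO_V d" using g uw by (auto simp: bij_betw_def)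
    ultimately show ?thesis using DO_E_iff_card_xor[OF assms(3)] uw by (simp add: edge_iff)
  qed
  then show ?thesis unfolding graph_iso_def using g by blast
qed

end

lemma graph_iso_K2_if_DO_1:
  assumes "graph_iso V E (DO_V 1) (DO_E 1)"
  shows "graph_iso V E (K_V 2) (K_E 2)"
proof -
  obtain g where g: "bij_betw g V (DO_V 1)" "\<And>u v. u \<in> V \<Longrightarrow> v \<in> V \<Longrightarrow> E u v \<longleftrightarrow> DO_E 1 (g u) (g v)"
    using assms by (auto simp: graph_iso_def)
  have DO: "DO_V 1 = {{}, {1}}" by (auto simp: DO_V_def)
  have "bij_betw card (DO_V 1) (K_V 2)" unfolding DO by (auto simp: bij_betw_def K_V_def)
  then have "bij_betw (card \<circ> g) V (K_V 2)" using g(1) bij_betw_trans by blast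
  moreover have "DO_E 1 A B \<longleftrightarrow> K_E 2 (card A) (card B)" if "A \<in> DO_V 1" "B \<in> DO_V 1" for A B
    using that unfolding DO_E_def K_E_def DO by auto
  moreover have "g u \<in> DO_V 1" if "u \<in> V" for u using g(1) that by (auto simp: bij_betw_def)
  ultimately show ?thesis unfolding graph_iso_def using g(2) by (intro exI[of _ "card \<circ> g"]) auto
qed

section \<open>Convex cycles in the middle layers\<close>

lemma DO_V_xor_singleton_iff:
  assumes "A \<in> DO_V k" "1 \<le> k" "e \<in> {1..2 * k - 1}"
  shows "A \<oplus> {e} \<in> DO_V k \<longleftrightarrow> (e \<in> A \<longleftrightarrow> card A = k)"
proof -
  have fin: "finite A" using finite_DO_V assms by blast
  have A: "A \<subseteq> {1..2 * k - 1}" "card A = k - 1 \<or> card A = k" using assms(1) by (auto simp: DO_V_def)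
  have "A \<oplus> {e} \<subseteq> {1..2 * k - 1}" using A(1) assms(3) by auto
  moreover have "0 < card A" if "e \<in> A" using that fin card_gt_0_iff by blast
  ultimately show ?thesis
    using A(2) assms(2) card_xor_singleton[OF fin, of e] by (auto simp: DO_V_def)
qed

text \<open>Along a path, elements are inserted and removed alternately, so the first and third of
  three flips go in the same sense and may be interchanged. Convexity puts the resulting second
  geodesic on the cycle.\<close>

lemma convex_cycle_DO_length:
  assumes "cube_labelling V E g" and gV: "g ` V = DO_V k" and k: "1 \<le> k"
    and cyc: "convex_cycle VH EH l V E"
  shows "l = 6"
proof -
  interpret cube_labelling V E g by fact
  obtain xs where l: "3 \<le> l" "length xs = l" "distinct xs" "set xs = VH"
    and EH: "\<And>u v. EH u v \<longleftrightarrow> (\<exists>i<l. (u = xs ! i \<and> v = xs ! ((i + 1) mod l))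
                                \<or> (v = xs ! i \<and> u = xs ! ((i + 1) mod l)))"
    using cyc unfolding convex_cycle_def is_cycle_def by blast
  have conv: "convex_subgraph VH EH V E" using cyc by (simp add: convex_cycle_def)
  then have subgr: "subgraph VH EH V E" by (simp add: convex_subgraph_def isometric_subgraph_def)
  have sub: "VH \<subseteq> V" "\<And>u v. EH u v \<Longrightarrow> E u v" using subgr by (simp_all add: subgraph_def)
  have convex: "walk EH ys" if "u \<in> VH" "v \<in> VH" "walk E ys" "hd ys = u" "last ys = v"
    "enat (length ys - 1) = gdist E u v" for u v ys
    using conv that unfolding convex_subgraph_def by blast
  have xs_eq: "xs ! i = xs ! j \<longleftrightarrow> i = j" if "i < l" "j < l" for i j
    using that l by (simp add: nth_eq_iff_index_eq)
  have EH_nth: "EH (xs ! i) w \<longleftrightarrow> (\<exists>j<l. w = xs ! j \<and> (j = (i + 1) mod l \<or> i = (j + 1) mod l))"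
    if "i < l" for i w
  proof -
    have mod: "(j + 1) mod l < l" for j by (rule mod_less_divisor) (use l in linarith)
    show ?thesis unfolding EH using xs_eq mod that by metis
  qed
  have edge: "E (xs ! i) (xs ! j)" if "i < l" "j < l" "j = (i + 1) mod l" for i j
    using EH_nth[OF that(1)] that sub(2) by blast
  have label: "g u \<in> DO_V k" if "u \<in> V" for u using gV that by blast
  have flip: "\<exists>e. g v = g u \<oplus> {e} \<and> e \<in> {1..2 * k - 1} \<and> (e \<in> g u \<longleftrightarrow> card (g u) = k)
      \<and> (card (g v) = k \<longleftrightarrow> card (g u) \<noteq> k)" if "E u v" for u v
  proof -
    have uv: "u \<in> V" "v \<in> V" "card (g u \<oplus> g v) = 1" using that by (auto simp: edge_iff)
    then obtain e where e: "g v = g u \<oplus> {e}" unfolding card_xor_eq_1_iff by blast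
    have "e \<in> g u \<or> e \<in> g v" unfolding e by auto
    then have e': "e \<in> {1..2 * k - 1}" using label[OF uv(1)] label[OF uv(2)] by (auto simp: DO_V_def)
    have "e \<in> g u \<longleftrightarrow> card (g u) = k"
      using DO_V_xor_singleton_iff[OF label[OF uv(1)] k e'] label[OF uv(2)] e by simp
    moreover have "card (g v) = k \<longleftrightarrow> card (g u) \<noteq> k"
      using card_xor_singleton[OF finite_label[OF uv(1)], of e] label[OF uv(1)] k calculation
      unfolding e by (auto simp: DO_V_def)
    ultimately show ?thesis using e e' by blast
  qed
  \<comment> \<open>\<open>p\<close> is the cyclic predecessor of \<open>xs ! 0\<close>, so the path
    studied is \<open>p\<close>, \<open>xs ! 0\<close>, \<open>xs ! 1\<close>,
    \<open>xs ! 2\<close>.\<close>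
  define p where "p = xs ! (l - 1)"
  have idx: "l - 1 < l" "0 < l" "1 < l" "2 < l" "0 = (l - 1 + 1) mod l" "1 = (0 + 1) mod l" "2 = (1 + 1) mod l"
    using l(1) by auto
  have E: "E p (xs ! 0)" "E (xs ! 0) (xs ! 1)" "E (xs ! 1) (xs ! 2)"
    unfolding p_def using edge idx by blast+
  have inV: "p \<in> VH" "xs ! 2 \<in> VH" "p \<in> V" "xs ! 2 \<in> V"
    using nth_mem[of "l - 1" xs] nth_mem[of 2 xs] idx(1,4) sub(1) unfolding l(2,4) p_def by blast+
  obtain x where x: "g (xs ! 0) = g p \<oplus> {x}" "x \<in> {1..2 * k - 1}" "x \<in> g p \<longleftrightarrow> card (g p) = k"
      "card (g (xs ! 0)) = k \<longleftrightarrow> card (g p) \<noteq> k"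
    using flip[OF E(1)] by blast
  obtain y where y: "g (xs ! 1) = g (xs ! 0) \<oplus> {y}" "y \<in> {1..2 * k - 1}"
      "y \<in> g (xs ! 0) \<longleftrightarrow> card (g (xs ! 0)) = k" "card (g (xs ! 1)) = k \<longleftrightarrow> card (g (xs ! 0)) \<noteq> k"
    using flip[OF E(2)] by blast
  obtain z where z: "g (xs ! 2) = g (xs ! 1) \<oplus> {z}" "z \<in> {1..2 * k - 1}"
      "z \<in> g (xs ! 1) \<longleftrightarrow> card (g (xs ! 1)) = k" "card (g (xs ! 2)) = k \<longleftrightarrow> card (g (xs ! 1)) \<noteq> k"
    using flip[OF E(3)] by blast
  \<comment> \<open>Layers alternate along edges, so three edges cannot return to the start.\<close>
  have "p \<noteq> xs ! 2" using x(4) y(4) z(4) by auto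
  then have "l \<noteq> 3" unfolding p_def by auto
  then have l4: "4 \<le> l" using l(1) by linarith
  have "p \<noteq> xs ! 1" "xs ! 0 \<noteq> xs ! 2" using xs_eq l4 by (auto simp: p_def)
  then have "x \<noteq> y" "y \<noteq> z"
    using x(1) y(1) z(1) inj_onD[OF inj, of p "xs ! 1"] inj_onD[OF inj, of "xs ! 0" "xs ! 2"] E
    by (auto simp: edge_iff xor_assoc)
  have "x \<noteq> z" using x(1,3,4) y(1,4) z(3) \<open>y \<noteq> z\<close> by auto
  then have mem: "y \<in> g p \<longleftrightarrow> card (g p) \<noteq> k" "z \<in> g p \<longleftrightarrow> card (g p) = k" "x \<noteq> z"
    using x(1,4) y(1,3,4) z(3) \<open>x \<noteq> y\<close> \<open>y \<noteq> z\<close> by auto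
  have "g p \<oplus> {z} \<in> DO_V k"
    using DO_V_xor_singleton_iff[OF label[OF inV(3)] k z(2)] mem(2) by simp
  then obtain w1 where w1: "w1 \<in> V" "g w1 = g p \<oplus> {z}" using gV by (metis imageE)
  have "E p w1" using w1 inV by (simp add: edge_iff)
  have "g w1 \<oplus> {y} \<in> DO_V k"
    using DO_V_xor_singleton_iff[OF label[OF w1(1)] k y(2)] mem \<open>y \<noteq> z\<close> flip[OF \<open>E p w1\<close>] w1(2) by auto
  then obtain w2 where w2: "w2 \<in> V" "g w2 = g w1 \<oplus> {y}" using gV by (metis imageE)
  have "E w1 w2" using w1 w2 by (simp add: edge_iff)
  have last: "g (xs ! 2) = g w2 \<oplus> {x}"
    unfolding w2(2) w1(2) z(1) y(1) x(1) by (auto simp: set_eq_iff)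
  have "E w2 (xs ! 2)" using last w2 inV by (simp add: edge_iff)
  have "g p \<oplus> g (xs ! 2) = {x, y, z}"
    unfolding z(1) y(1) x(1) using \<open>x \<noteq> y\<close> \<open>y \<noteq> z\<close> mem(3) by (auto simp: set_eq_iff)
  then have card3: "card (g p \<oplus> g (xs ! 2)) = 3" using \<open>x \<noteq> y\<close> \<open>y \<noteq> z\<close> mem(3) by simp
  let ?w = "[p, w1, w2, xs ! 2]"
  have walk: "walk E ?w" using \<open>E p w1\<close> \<open>E w1 w2\<close> \<open>E w2 (xs ! 2)\<close> by (simp add: walk_Cons)
  have "gdist E p (xs ! 2) = enat 3"
  proof (rule gdist_eqI[OF walk])
    fix ys assume "walk E ys" "hd ys = p" "last ys = xs ! 2"
    then show "3 \<le> length ys - 1" using card_xor_le_walk_length[of ys] inV(3) card3 by simp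
  qed auto
  then have "walk EH ?w" using convex[OF inV(1,2) walk] by simp
  then have EHw: "EH p w1" "EH w1 w2" "EH w2 (xs ! 2)" by (auto simp: walk_Cons)
  have sym: "EH v u" if "EH u v" for u v using that unfolding EH by blast
  have mod: "(j + 1) mod l = (if j + 1 = l then 0 else j + 1)" if "j < l" for j using that by simp
  \<comment> \<open>On the cycle, \<open>p\<close> has only the neighbours at indices 0 and
    \<open>l - 2\<close>, and \<open>xs ! 2\<close> only those at 1 and 3. This locates
    \<open>w1\<close> and \<open>w2\<close>.\<close>
  have "w1 \<noteq> xs ! 0" using w1(2) x(1) mem(3) by auto
  moreover obtain i where i: "i < l" "w1 = xs ! i" "i = (l - 1 + 1) mod l \<or> l - 1 = (i + 1) mod l"
    using EHw(1) EH_nth[OF idx(1)] unfolding p_def by blast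
  ultimately have i2: "i = l - 2" using mod[OF i(1)] l4 by (auto split: if_splits)
  have "g w2 \<noteq> g (xs ! 1)" "g w2 \<noteq> g p"
    unfolding w2(2) w1(2) y(1) x(1) using mem(3) \<open>y \<noteq> z\<close> by (auto simp: xor_assoc set_eq_iff)
  then have "w2 \<noteq> xs ! 1" "w2 \<noteq> p" by auto
  moreover obtain j where j: "j < l" "w2 = xs ! j" "j = (2 + 1) mod l \<or> 2 = (j + 1) mod l"
    using sym[OF EHw(3)] EH_nth[OF idx(4)] by blast
  ultimately have j3: "j = 3" using mod[OF j(1)] mod[OF idx(4)] l4 by (auto split: if_splits)
  have "l \<noteq> 4" using \<open>w2 \<noteq> p\<close> j(2) j3 by (auto simp: p_def)
  \<comment> \<open>The edge from \<open>w1\<close> to \<open>w2\<close> makes \<open>l - 2\<close>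
    and 3 cyclically consecutive; as \<open>l = 4\<close> is excluded, \<open>l - 2\<close> is
    4.\<close>
  have "j = (i + 1) mod l \<or> i = (j + 1) mod l"
    using EHw(2) EH_nth[OF i(1), of w2] xs_eq j i(2) by auto
  then show "l = 6"
    using mod[OF i(1)] mod[OF j(1)] i2 j3 l4 \<open>l \<noteq> 4\<close> by (auto split: if_splits)
qed

section \<open>The characterization\<close>

lemma graph_iso_K1_if_singleton:
  assumes "graph {u} E"
  shows "graph_iso {u} E (K_V 1) (K_E 1)"
  unfolding graph_iso_def
  using assms by (intro exI[of _ "\<lambda>_. 0"]) (auto simp: bij_betw_def K_V_def K_E_def graph_def)

theorem theorem1p1:
  fixes V :: "'a set" and E :: "'a \<Rightarrow> 'a \<Rightarrow> bool"
  assumes "graph V E" and "V \<noteq> {}"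
    and "regular V E"
    and "partial_cube V E"
    and "\<not> graph_iso V E (K_V 1) (K_E 1)"
    and "\<not> graph_iso V E (K_V 2) (K_E 2)"
  shows "(\<forall>(VH :: 'a set) EH l. convex_cycle VH EH l V E \<longrightarrow> l = 6)
     \<longleftrightarrow> (\<exists>k\<ge>2. graph_iso V E (DO_V k) (DO_E k))"
proof
  assume hex: "\<forall>(VH :: 'a set) EH l. convex_cycle VH EH l V E \<longrightarrow> l = 6"
  have finV: "finite V" using assms(1) by (simp add: graph_def)
  obtain f :: "'a \<Rightarrow> nat set" where "isometric_labelling V E f"
    using partial_cube_imp_isometric_labelling[OF assms(1,4)] by blast
  then interpret isometric_labelling V E f .
  obtain d where d: "\<And>v. v \<in> V \<Longrightarrow> card {u \<in> V. E v u} = d"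
    using assms(3) by (auto simp: regular_def)
  \<comment> \<open>With degree 0 no step towards a second vertex is possible, so the graph would be
    a single vertex.\<close>
  have "d \<noteq> 0"
  proof
    assume "d = 0"
    obtain u where u: "u \<in> V" using assms(2) by blast
    have "v = u" if v: "v \<in> V" for v
    proof (rule ccontr)
      assume "v \<noteq> u"
      then obtain e w where "w \<in> V" "f w = f u \<oplus> {e}" using isometric_step[OF u v] by auto
      then have "w \<in> {w \<in> V. E u w}" using u by (simp add: edge_iff)
      then show False using d[OF u] \<open>d = 0\<close> finV by auto
    qed
    then have "V = {u}" using u by blast
    then show False using graph_iso_K1_if_singleton[of u E] assms(1,5) by simp
  qed
  have "hexagonal_family (f ` V)" using hexagonal_family_labels[OF finV] hex by blast
  then interpret R: regular_hexagonal_family "f ` V" d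
    using finV d \<open>d \<noteq> 0\<close>
    by (auto simp: regular_hexagonal_family_def regular_hexagonal_family_axioms_def card_dirs_eq_degree)
  obtain S v where "finite v" "card v = 2 * d - 1"
    "(\<oplus>) S ` f ` V = {Z. Z \<subseteq> v \<and> (card Z = d - 1 \<or> card Z = d)}"
    using R.family_eq_middle_layers assms(2) by blast
  then have iso: "graph_iso V E (DO_V d) (DO_E d)"
    using graph_iso_DO_if_middle_layers \<open>d \<noteq> 0\<close> by simp
  \<comment> \<open>Degree 1 would give the Doubled Odd graph with \<open>k = 1\<close>, a single
    edge.\<close>
  moreover have "d \<noteq> 1" using iso graph_iso_K2_if_DO_1 assms(6) by blast
  ultimately show "\<exists>k\<ge>2. graph_iso V E (DO_V k) (DO_E k)"
    using \<open>d \<noteq> 0\<close> by (intro exI[of _ d]) auto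
next
  assume "\<exists>k\<ge>2. graph_iso V E (DO_V k) (DO_E k)"
  then obtain k g where k: "2 \<le> k" and g: "bij_betw g V (DO_V k)"
    "\<And>u v. u \<in> V \<Longrightarrow> v \<in> V \<Longrightarrow> E u v \<longleftrightarrow> DO_E k (g u) (g v)"
    by (auto simp: graph_iso_def)
  have gV: "g ` V = DO_V k" "inj_on g V" using g(1) by (auto simp: bij_betw_def)
  have "cube_labelling V E g"
  proof
    show "finite (g u)" if "u \<in> V" for u using that gV finite_DO_V by blast
    have "E u v \<longleftrightarrow> card (g u \<oplus> g v) = 1" if "u \<in> V" "v \<in> V" for u v
      using DO_E_iff_card_xor[of k "g u" "g v"] that gV(1) g(2) k by auto
    then show "E u v \<longleftrightarrow> u \<in> V \<and> v \<in> V \<and> card (g u \<oplus> g v) = 1" for u v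
      using assms(1) unfolding graph_def by blast
  qed (rule gV)
  then show "\<forall>(VH :: 'a set) EH l. convex_cycle VH EH l V E \<longrightarrow> l = 6"
    using convex_cycle_DO_length[OF _ gV(1)] k by auto
qed

end
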